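(* The positive definite quadratic form $$Q^{pc}_6=Q_{\mathsf{E}_6^*}+\frac{\sqrt{798}-18}{79}\,R_1$$ is a locally optimal solution to the lattice packing-covering problem, lying in the interior of its secondary cone. Its lattice packing-covering constant is $$\gamma(Q^{pc}_6)=2\sqrt{2\sqrt{798}-56}\approx 1.411081242.$$
   Context: For a positive definite quadratic form (PQF) $Q$, i.e. a positive definite real symmetric $d\times d$ matrix with $Q[x]=x^tQx$, put $\mu(Q)=\max_{x\in\mathbb{R}^d}\min_{v\in\mathbb{Z}^d}Q[x-v]$, $\lambda(Q)=\min_{v\in\mathbb{Z}^d\setminus\{0\}}Q[v]$ and $\gamma(Q)=2\sqrt{\mu(Q)/\lambda(Q)}$. $Q$ is a locally optimal solution to the lattice packing-covering problem if $Q$ is a local minimum of $\gamma$ on the open cone of all PQFs in $d$ variables (equivalently, after scaling to $\mu(Q)=1$, a local maximum of $\lambda$ among PQFs with $\mu=1$). A polytope $\mathrm{conv}\{v_1,\dots,v_n\}$ with $v_i\in\mathbb{Z}^d$ is a Delone polytope of $Q$ if there are $c\in\mathbb{R}^d$, $r\in\mathbb{R}$ with $Q[v_i-c]=r^2$ for all $i$ and $Q[v-c]>r^2$ for all other $v\in\mathbb{Z}^d$; $\mathrm{Del}(Q)$ is the set of all Delone polytopes of $Q$. "$Q$ lies in the interior of its secondary cone" means that $\mathrm{Del}(Q)$ is a triangulation (consists of simplices only), so that $Q$ lies in the full-dimensional open cone $\mathbf{\Delta}(\mathrm{Del}(Q))=\{Q' \text{ a PQF}:\mathrm{Del}(Q')=\mathrm{Del}(Q)\}$.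 Here $$Q_{\mathsf{E}_6^*}=\begin{pmatrix}4&1&2&2&-1&1\\1&4&2&2&2&1\\2&2&4&1&1&2\\2&2&1&4&1&2\\-1&2&1&1&4&2\\1&1&2&2&2&4\end{pmatrix},\quad R_1=\begin{pmatrix}12&3&6&6&-3&3\\3&7&4&4&3&2\\6&4&8&3&1&4\\6&4&3&8&1&4\\-3&3&1&1&7&3\\3&2&4&4&3&7\end{pmatrix}.$$ *)

theory Defs
  imports "HOL-Analysis.Analysis"
begin

definition qform :: "real^'n^'n \<Rightarrow> real^'n \<Rightarrow> real" where
  "qform Q x = x \<bullet> (Q *v x)"

definition pqf :: "(real^'n^'n) set" where
  "pqf = {Q. transpose Q = Q \<and> (\<forall>x. x \<noteq> 0 \<longrightarrow> qform Q x > 0)}"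

definition int_vecs :: "(real^'n) set" where
  "int_vecs = {v. \<forall>i. v $ i \<in> \<int>}"

(* The maxima and minima below are written as suprema and infima: for a positive
   definite form they are attained, every value set of qform being bounded below by 0,
   with only finitely many lattice vectors below any given bound, and the minimum in mu
   being a continuous, Z^d-periodic function of x. *)

definition covering_mu :: "real^'n^'n \<Rightarrow> real" where
  "covering_mu Q = (SUP x. INF v\<in>int_vecs. qform Q (x - v))"

definition packing_lambda :: "real^'n^'n \<Rightarrow> real" where
  "packing_lambda Q = (INF v\<in>int_vecs - {0}. qform Q v)"

definition packing_covering_gamma :: "real^'n^'n \<Rightarrow> real" where
  "packing_covering_gamma Q = 2 * sqrt (covering_mu Q / packing_lambda Q)"

definition locally_optimal_packing_covering :: "real^'n^'n \<Rightarrow> bool" where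
  "locally_optimal_packing_covering Q \<longleftrightarrow> Q \<in> pqf \<and>
     (\<forall>\<^sub>F Q' in at Q within pqf. packing_covering_gamma Q \<le> packing_covering_gamma Q')"

(* Polytopes of every dimension qualify, lattice points (r = 0) included, so the Delone
   polytopes form a face-closed subdivision. *)
definition delone_polytope :: "real^'n^'n \<Rightarrow> (real^'n) set \<Rightarrow> bool" where
  "delone_polytope Q P \<longleftrightarrow>
     (\<exists>V c r. finite V \<and> V \<noteq> {} \<and> V \<subseteq> int_vecs \<and> P = convex hull V \<and>
        (\<forall>v\<in>V. qform Q (v - c) = r^2) \<and>
        (\<forall>v\<in>int_vecs - V. qform Q (v - c) > r^2))"

definition Del :: "real^'n^'n \<Rightarrow> (real^'n) set set" where
  "Del Q = {P. delone_polytope Q P}"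

definition triangulation :: "(real^'n) set set \<Rightarrow> bool" where
  "triangulation D \<longleftrightarrow> (\<forall>P\<in>D. \<exists>k. k simplex P)"

definition secondary_cone :: "(real^'n) set set \<Rightarrow> (real^'n^'n) set" where
  "secondary_cone D = {Q \<in> pqf. Del Q = D}"

(* The interior is taken in the space of symmetric matrices; in the space of all matrices
   it would be empty. *)
definition in_interior_of_secondary_cone :: "real^'n^'n \<Rightarrow> bool" where
  "in_interior_of_secondary_cone Q \<longleftrightarrow>
     triangulation (Del Q) \<and>
     Q \<in> top_of_set {A. transpose A = A} interior_of secondary_cone (Del Q)"

definition Q_E6_dual :: "real^6^6" where
  "Q_E6_dual = vector
     [vector [ 4, 1, 2, 2, -1, 1],
      vector [ 1, 4, 2, 2,  2, 1],
      vector [ 2, 2, 4, 1,  1, 2],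
      vector [ 2, 2, 1, 4,  1, 2],
      vector [-1, 2, 1, 1,  4, 2],
      vector [ 1, 1, 2, 2,  2, 4]]"

definition R1 :: "real^6^6" where
  "R1 = vector
     [vector [12, 3, 6, 6, -3, 3],
      vector [ 3, 7, 4, 4,  3, 2],
      vector [ 6, 4, 8, 3,  1, 4],
      vector [ 6, 4, 3, 8,  1, 4],
      vector [-3, 3, 1, 1,  7, 3],
      vector [ 3, 2, 4, 4,  3, 7]]"

definition Q_pc_6 :: "real^6^6" where
  "Q_pc_6 = Q_E6_dual + ((sqrt 798 - 18) / 79) *\<^sub>R R1"

end

(* Write Q = E + t R with t > 0. Take a family of unimodular lattice simplices, invariant under
   translations, in which every facet of a simplex V is shared with a simplex W such that the vertex
   of V opposite to the facet lies strictly outside the circumsphere of W. For a point x choose a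
   simplex minimising the power of x with respect to its circumsphere; crossing a facet would decrease
   the power if x were not in that simplex. Hence the simplices cover the space, all circumspheres
   are empty, and the Delone polytopes of Q are exactly the faces of the family. The local condition
   consists of finitely many strict inequalities linear in Q, so it persists near Q.

   For Q_pc_6 the family has three orbits under translations and the lattice isometries common to
   E and R. Shortest vectors are edges of the triangulation, which gives lambda = 4 + 7 t. For a
   simplex with barycentric weights a_v of its circumcentre c with respect to Q, every nearby form
   satisfies mu(Q') >= sum a_v Q'[v - c], with equality at Q. Averaged over the isometry group this
   bound only sees the invariant forms, which are spanned by E and R, and on those it equals
   kappa Q'[e] for a shortest vector e, with kappa = 2 sqrt 798 - 56. Hence mu(Q') >= kappa lambda(Q')
   near Q. *)
theory Submission
  imports Defs
begin

section \<open>Quadratic forms on lattice points\<close>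

text \<open>The obstacle is to show that explicit simplices cover the space and have empty
  circumspheres without volumes and without enumerating lattice points. Powers achieve this: the
  power of x for the circumsphere of V is Q[x] minus the affine function interpolating Q on V. A
  cell of least power is one whose interpolant is largest at x, and differences of powers are
  affine, hence determined by their values at vertices. The local conditions use affine relations
  between lattice points. These do not depend on the form, so under a perturbation only the values
  of Q at fixed points move. Origin of the factor t: the linear lower bound for mu touches the
  squared circumradius at Q and is therefore its gradient there. Local optimality asks that, on
  invariant forms, this gradient be proportional to the gradient (4, 7) of the packing minimum in
  the coordinates given by E and R. As the invariant forms have dimension two, this is one equation
  in t: the squared circumradius divided by 4 + 7 t is stationary.\<close>

lemma sym_matrix_inner:
  fixes Q :: "real^'n^'n"
  assumes "transpose Q = Q"
  shows "x \<bullet> (Q *v y) = y \<bullet> (Q *v x)"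
  by (metis assms dot_lmul_matrix inner_commute transpose_matrix_vector)

lemma qform_add:
  fixes Q :: "real^'n^'n"
  assumes "transpose Q = Q"
  shows "qform Q (x + y) = qform Q x + 2 * (x \<bullet> (Q *v y)) + qform Q y"
  using sym_matrix_inner[OF assms, of x y]
  by (simp add: qform_def matrix_vector_right_distrib inner_add_left inner_add_right)

lemma qform_minus [simp]: "qform Q (- x) = qform Q x"
  by (simp add: qform_def linear_neg[OF matrix_vector_mul_linear])

lemma qform_minus_commute: "qform Q (x - y) = qform Q (y - x)"
  by (metis minus_diff_eq qform_minus)

lemma qform_scaleR [simp]: "qform Q (a *\<^sub>R x) = a\<^sup>2 * qform Q x"
  by (simp add: qform_def matrix_vector_mult_scaleR power2_eq_square)

lemma qform_zero [simp]: "qform Q 0 = 0"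
  by (simp add: qform_def)

lemma qform_add_matrix: "qform (A + B) x = qform A x + qform B x"
  by (simp add: qform_def matrix_vector_mult_add_rdistrib inner_add_right)

lemma qform_scaleR_matrix: "qform (a *\<^sub>R A) x = a * qform A x"
  by (simp add: qform_def scaleR_matrix_vector_assoc[symmetric])

lemma qform_sum_matrix: "qform (\<Sum>i\<in>I. A i) x = (\<Sum>i\<in>I. qform (A i) x)"
  by (induction I rule: infinite_finite_induct) (simp_all add: qform_add_matrix, simp_all add: qform_def)

lemma qform_diff_scaled:
  fixes Q :: "real^'n^'n"
  assumes "transpose Q = Q"
  shows "qform Q (x - y) = qform Q x - 2 * (x \<bullet> (Q *v y)) + qform Q y"
  using qform_add[OF assms, of x "- y"]
  by (simp add: linear_neg[OF matrix_vector_mul_linear])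

lemma parallelogram_qform:
  fixes Q :: "real^'n^'n"
  assumes "transpose Q = Q"
  shows "qform Q (x + y) + qform Q (x - y) = 2 * qform Q x + 2 * qform Q y"
  using qform_add[OF assms, of x y] qform_diff_scaled[OF assms, of x y] by simp

text \<open>Huygens-Steiner identity: the cross term vanishes because x is the weighted mean.
  Weights may be negative, so x may lie outside the convex hull of \<open>V\<close>.\<close>

lemma qform_weighted_sum:
  fixes Q :: "real^'n^'n"
  assumes Q: "transpose Q = Q" and fin: "finite V" and one: "sum \<alpha> V = 1"
    and x: "x = (\<Sum>v\<in>V. \<alpha> v *\<^sub>R v)"
  shows "(\<Sum>v\<in>V. \<alpha> v * qform Q (v - c)) = qform Q (x - c) + (\<Sum>v\<in>V. \<alpha> v * qform Q (v - x))"
proof -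
  have "(\<Sum>v\<in>V. \<alpha> v * ((v - x) \<bullet> (Q *v (x - c)))) = ((\<Sum>v\<in>V. \<alpha> v *\<^sub>R v) - sum \<alpha> V *\<^sub>R x) \<bullet> (Q *v (x - c))"
    by (simp add: inner_sum_left inner_diff_left right_diff_distrib sum_subtractf sum_distrib_right)
  then have 0: "(\<Sum>v\<in>V. \<alpha> v * ((v - x) \<bullet> (Q *v (x - c)))) = 0"
    by (simp add: one x)
  have *: "qform Q (v - c) = qform Q (v - x) + 2 * ((v - x) \<bullet> (Q *v (x - c))) + qform Q (x - c)" for v
    using qform_add[OF Q, of "v - x" "x - c"] by simp
  have "(\<Sum>v\<in>V. \<alpha> v * qform Q (v - c))
      = (\<Sum>v\<in>V. \<alpha> v * (qform Q (v - x) + 2 * ((v - x) \<bullet> (Q *v (x - c))) + qform Q (x - c)))"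
    by (rule sum.cong[OF refl]) (subst *, rule refl)
  also have "\<dots> = (\<Sum>v\<in>V. \<alpha> v * qform Q (v - x))
      + 2 * (\<Sum>v\<in>V. \<alpha> v * ((v - x) \<bullet> (Q *v (x - c)))) + sum \<alpha> V * qform Q (x - c)"
    by (simp add: distrib_left sum.distrib sum_distrib_left sum_distrib_right mult.left_commute[of _ 2])
  finally show ?thesis
    using 0 one by simp
qed

lemma pqf_sym: "Q \<in> pqf \<Longrightarrow> transpose Q = Q"
  by (simp add: pqf_def)

lemma pqf_pos: "Q \<in> pqf \<Longrightarrow> x \<noteq> 0 \<Longrightarrow> 0 < qform Q x"
  by (simp add: pqf_def)

lemma pqf_nonneg: "Q \<in> pqf \<Longrightarrow> 0 \<le> qform Q x"
  using pqf_pos[of Q x] by (cases "x = 0") auto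

lemma continuous_on_qform [continuous_intros]:
  "continuous_on S f \<Longrightarrow> continuous_on S (\<lambda>x. qform Q (f x))"
  unfolding qform_def by (intro continuous_intros matrix_vector_mult_linear_continuous_on[THEN continuous_on_compose2]) auto

lemma pqf_coercive:
  fixes Q :: "real^'n^'n"
  assumes "Q \<in> pqf"
  obtains a where "a > 0" "\<And>x. a * (norm x)\<^sup>2 \<le> qform Q x"
proof -
  \<comment> \<open>The constant is the minimum of the form on the unit sphere; homogeneity carries
    the bound to all vectors.\<close>
  have "\<exists>x\<in>sphere 0 1. \<forall>y\<in>sphere 0 1. qform Q x \<le> qform Q (y::real^'n)"
    by (rule continuous_attains_inf) (auto intro!: continuous_intros)
  then obtain u where u: "norm u = 1" "\<And>y. norm y = 1 \<Longrightarrow> qform Q u \<le> qform Q (y::real^'n)"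
    by auto
  have "qform Q u * (norm x)\<^sup>2 \<le> qform Q x" for x
  proof (cases "x = 0")
    case False
    have "qform Q x = qform Q (norm x *\<^sub>R sgn x)"
      by (simp add: sgn_div_norm False)
    also have "\<dots> = (norm x)\<^sup>2 * qform Q (sgn x)"
      by simp
    finally show ?thesis
      using u(2)[of "sgn x"] False by (simp add: norm_sgn mult.commute mult_left_mono)
  qed auto
  moreover have "qform Q u > 0"
    using u(1) by (intro pqf_pos[OF assms]) auto
  ultimately show thesis
    using that by blast
qed

section \<open>The integer lattice and its points of bounded length\<close>

lemma int_vecs_zero [simp]: "0 \<in> int_vecs"
  by (simp add: int_vecs_def)

lemma int_vecs_add: "x \<in> int_vecs \<Longrightarrow> y \<in> int_vecs \<Longrightarrow> x + y \<in> int_vecs"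
  by (simp add: int_vecs_def)

lemma int_vecs_diff: "x \<in> int_vecs \<Longrightarrow> y \<in> int_vecs \<Longrightarrow> x - y \<in> int_vecs"
  by (simp add: int_vecs_def)

lemma int_vecs_axis: "axis i 1 \<in> int_vecs"
  by (auto simp: int_vecs_def axis_def)

lemma finite_int_vecs_norm_le: "finite {v \<in> int_vecs :: (real^'n) set. norm v \<le> B}"
proof (rule finite_subset)
  show "{v \<in> int_vecs. norm v \<le> B} \<subseteq> (\<lambda>f. \<chi> i. of_int (f i)) ` PiE (UNIV::'n set) (\<lambda>_. {-\<lceil>B\<rceil>..\<lceil>B\<rceil>})"
  proof
    fix v :: "real^'n"
    assume "v \<in> {v \<in> int_vecs. norm v \<le> B}"
    then have v: "v \<in> int_vecs" "norm v \<le> B"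
      by auto
    have "\<lfloor>v $ i\<rfloor> \<in> {-\<lceil>B\<rceil>..\<lceil>B\<rceil>}" for i
      using component_le_norm_cart[of v i] v(2) by (simp; linarith)
    moreover have "v = (\<chi> i. of_int \<lfloor>v $ i\<rfloor>)"
      using v(1) by (auto simp: int_vecs_def vec_eq_iff)
    ultimately show "v \<in> (\<lambda>f. \<chi> i. of_int (f i)) ` PiE (UNIV::'n set) (\<lambda>_. {-\<lceil>B\<rceil>..\<lceil>B\<rceil>})"
      by (intro image_eqI[where x = "\<lambda>i. \<lfloor>v $ i\<rfloor>"]) auto
  qed
qed (auto intro!: finite_imageI finite_PiE)

lemma finite_int_vecs_qform_le:
  fixes Q :: "real^'n^'n"
  assumes "Q \<in> pqf"
  shows "finite {v \<in> int_vecs. qform Q (v - c) \<le> K}"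
proof -
  obtain a where a: "a > 0" "\<And>x. a * (norm x)\<^sup>2 \<le> qform Q x"
    using pqf_coercive[OF assms] by blast
  have "norm v \<le> norm c + sqrt (K / a)" if "qform Q (v - c) \<le> K" for v
  proof -
    have "(norm (v - c))\<^sup>2 \<le> K / a"
      using a(2)[of "v - c"] that a(1) by (simp add: field_simps)
    then have "norm (v - c) \<le> sqrt (K / a)"
      by (rule real_le_rsqrt)
    then show ?thesis
      using norm_triangle_ineq2[of v c] by linarith
  qed
  then show ?thesis
    by (intro finite_subset[OF _ finite_int_vecs_norm_le[of "norm c + sqrt (K / a)"]]) auto
qed

lemma int_vecs_norm_ge_1:
  fixes v :: "real^'n"
  assumes "v \<in> int_vecs" "v \<noteq> 0"
  shows "1 \<le> norm v"
proof -
  obtain i where "v $ i \<noteq> 0"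
    using assms(2) by (auto simp: vec_eq_iff)
  then have "1 \<le> \<bar>v $ i\<bar>"
    using assms(1) Ints_nonzero_abs_ge1 by (auto simp: int_vecs_def)
  then show ?thesis
    using component_le_norm_cart[of v i] by linarith
qed

section \<open>Bounds for the packing minimum and the covering radius\<close>

lemma bdd_below_qform_int_vecs: "Q \<in> pqf \<Longrightarrow> bdd_below ((\<lambda>v. qform Q (f v)) ` S)"
  by (rule bdd_belowI2[where m = 0]) (simp add: pqf_nonneg)

lemma packing_lambda_le: "Q \<in> pqf \<Longrightarrow> v \<in> int_vecs \<Longrightarrow> v \<noteq> 0 \<Longrightarrow> packing_lambda Q \<le> qform Q v"
  unfolding packing_lambda_def by (rule cINF_lower) (auto intro: bdd_below_qform_int_vecs)

lemma packing_lambda_ge: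
  fixes Q :: "real^'n^'n"
  assumes "\<And>v. v \<in> int_vecs \<Longrightarrow> v \<noteq> 0 \<Longrightarrow> l \<le> qform Q v"
  shows "l \<le> packing_lambda Q"
proof -
  have "axis undefined 1 \<in> (int_vecs - {0} :: (real^'n) set)"
    using int_vecs_axis by auto
  then show ?thesis
    unfolding packing_lambda_def using assms by (intro cINF_greatest) blast+
qed

lemma packing_lambda_pos:
  fixes Q :: "real^'n^'n"
  assumes "Q \<in> pqf"
  shows "0 < packing_lambda Q"
proof -
  obtain a where a: "a > 0" "\<And>x. a * (norm x)\<^sup>2 \<le> qform Q x"
    using pqf_coercive[OF assms] by blast
  have "a \<le> qform Q v" if "v \<in> int_vecs" "v \<noteq> 0" for v
  proof -
    have "a * 1 \<le> a * (norm v)\<^sup>2"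
      using a(1) int_vecs_norm_ge_1[OF that] by (intro mult_left_mono one_le_power) auto
    then show ?thesis
      using a(2)[of v] by simp
  qed
  then have "a \<le> packing_lambda Q"
    by (rule packing_lambda_ge)
  then show ?thesis
    using a(1) by simp
qed

lemma covering_INF_le: "Q \<in> pqf \<Longrightarrow> v \<in> int_vecs \<Longrightarrow> (INF v\<in>int_vecs. qform Q (x - v)) \<le> qform Q (x - v)"
  by (rule cINF_lower) (auto intro: bdd_below_qform_int_vecs)

lemma covering_mu_le:
  assumes "Q \<in> pqf" "\<And>x. \<exists>v\<in>int_vecs. qform Q (x - v) \<le> m"
  shows "covering_mu Q \<le> m"
  unfolding covering_mu_def
  by (intro cSUP_least) (use assms covering_INF_le order_trans in blast)+

text \<open>Lower bounds for the supremum \<open>covering_mu\<close> require boundedness. Rounding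
  coordinates down moves x into the unit cube, where the form is bounded by compactness.\<close>

lemma bdd_above_covering:
  fixes Q :: "real^'n^'n"
  assumes "Q \<in> pqf"
  shows "bdd_above (range (\<lambda>x. INF v\<in>int_vecs. qform Q (x - v)))"
proof -
  have "compact {x::real^'n. \<forall>i. x $ i \<in> {0..1}}"
    using compact_cbox[of "0::real^'n" "\<chi> i. 1"] by (simp add: cbox_def Basis_vec_def inner_axis)
  then have "bounded (qform Q ` {x::real^'n. \<forall>i. x $ i \<in> {0..1}})"
    by (intro compact_imp_bounded compact_continuous_image continuous_intros)
  then obtain B where "\<forall>y\<in>qform Q ` {x::real^'n. \<forall>i. x $ i \<in> {0..1}}. norm y \<le> B"
    unfolding bounded_iff by blast
  then have B: "qform Q x \<le> B" if "\<And>i. x $ i \<in> {0..1}" for x :: "real^'n"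
    using that by (auto simp: abs_le_iff)
  have "(INF v\<in>int_vecs. qform Q (x - v)) \<le> B" for x
  proof -
    have "(INF v\<in>int_vecs. qform Q (x - v)) \<le> qform Q (x - (\<chi> i. of_int \<lfloor>x $ i\<rfloor>))"
      by (intro covering_INF_le assms) (auto simp: int_vecs_def)
    also have "\<dots> \<le> B"
    proof (rule B)
      fix i
      show "(x - (\<chi> i. of_int \<lfloor>x $ i\<rfloor>)) $ i \<in> {0..1}"
        using floor_correct[of "x $ i"] by simp linarith
    qed
    finally show ?thesis .
  qed
  then show ?thesis
    by (intro bdd_aboveI2[where M = B])
qed

lemma covering_mu_ge:
  fixes Q :: "real^'n^'n"
  assumes "Q \<in> pqf" "\<And>v. v \<in> int_vecs \<Longrightarrow> r \<le> qform Q (v - c)"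
  shows "r \<le> covering_mu Q"
proof -
  have "r \<le> (INF v\<in>int_vecs. qform Q (c - v))"
    using assms(2) int_vecs_zero by (intro cINF_greatest) (blast, simp add: qform_minus_commute[of Q c])
  also have "\<dots> \<le> covering_mu Q"
    unfolding covering_mu_def by (intro cSUP_upper bdd_above_covering assms(1)) auto
  finally show ?thesis .
qed

section \<open>Families of unimodular simplices\<close>

text \<open>The group GL(n, Z), as maps rather than matrices, since it acts on sets of
  vertices.\<close>

definition lattice_aut :: "(real^'n \<Rightarrow> real^'n) \<Rightarrow> bool" where
  "lattice_aut f \<longleftrightarrow> linear f \<and> bij f \<and> f ` int_vecs = int_vecs"

text \<open>These are the lattice simplices of least volume 1/n!: the vertices form an affine basis
  of the lattice.\<close>

definition unimodular_simplex :: "(real^'n) set \<Rightarrow> bool" where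
  "unimodular_simplex V \<longleftrightarrow>
     (\<exists>f t. lattice_aut f \<and> t \<in> int_vecs \<and> V = (\<lambda>x. t + f x) ` insert 0 Basis)"

lemma Basis_eq_range_axis: "(Basis :: (real^'n) set) = range (\<lambda>i. axis i 1)"
  by (auto simp: Basis_vec_def)

lemma Basis_subset_int_vecs: "Basis \<subseteq> (int_vecs :: (real^'n) set)"
  by (auto simp: Basis_vec_def int_vecs_axis)

lemma lattice_aut_int_vecs: "lattice_aut f \<Longrightarrow> x \<in> int_vecs \<Longrightarrow> f x \<in> int_vecs"
  by (auto simp: lattice_aut_def)

lemma lattice_aut_comp: "lattice_aut f \<Longrightarrow> lattice_aut g \<Longrightarrow> lattice_aut (f \<circ> g)"
  unfolding lattice_aut_def by (metis bij_comp image_comp linear_compose)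

lemma unimodular_simplex_aut_image:
  assumes "unimodular_simplex V" "lattice_aut g" "s \<in> int_vecs"
  shows "unimodular_simplex ((\<lambda>x. s + g x) ` V)"
proof -
  obtain f t where f: "lattice_aut f" "t \<in> int_vecs" "V = (\<lambda>x. t + f x) ` insert 0 Basis"
    using assms(1) by (auto simp: unimodular_simplex_def)
  have "linear g"
    using assms(2) by (simp add: lattice_aut_def)
  then have "(\<lambda>x. s + g x) ` V = (\<lambda>x. (s + g t) + (g \<circ> f) x) ` insert 0 Basis"
    unfolding f(3) image_image by (simp add: linear_add add.assoc)
  then show ?thesis
    unfolding unimodular_simplex_def using f assms
    by (intro exI[of _ "g \<circ> f"] exI[of _ "s + g t"]) (simp add: lattice_aut_comp int_vecs_add lattice_aut_int_vecs)
qed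

lemma lattice_aut_id: "lattice_aut id"
  by (simp add: lattice_aut_def linear_id)

lemma unimodular_simplex_translation:
  "unimodular_simplex V \<Longrightarrow> s \<in> int_vecs \<Longrightarrow> unimodular_simplex ((+) s ` V)"
  using unimodular_simplex_aut_image[OF _ lattice_aut_id, of V s] by simp

text \<open>Most claims are transported from the standard simplex. The last one turns a lattice
  point in the hull of a cell into a vertex, the step from covering to empty spheres in
  \<open>empty_circumsphere\<close>.\<close>

lemma
  fixes V :: "(real^'n) set"
  assumes "unimodular_simplex V"
  shows unimodular_simplex_finite: "finite V"
    and unimodular_simplex_nonempty: "V \<noteq> {}"
    and unimodular_simplex_int: "V \<subseteq> int_vecs"
    and unimodular_simplex_affine_hull: "affine hull V = UNIV"
    and unimodular_simplex_affine_independent: "\<not> affine_dependent V"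
    and unimodular_simplex_lattice_points: "convex hull V \<inter> int_vecs \<subseteq> V"
proof -
  obtain f t where ft: "lattice_aut f" "t \<in> int_vecs" and V: "V = (\<lambda>x. t + f x) ` insert 0 Basis"
    using assms unfolding unimodular_simplex_def by blast
  then have f: "linear f" "bij f" "f ` int_vecs = int_vecs" "t \<in> int_vecs"
    by (simp_all add: lattice_aut_def)
  have V': "V = (+) t ` f ` insert 0 Basis"
    by (simp add: V image_image)
  show "finite V" "V \<noteq> {}"
    by (simp_all add: V)
  show "V \<subseteq> int_vecs"
  proof
    fix v
    assume "v \<in> V"
    then obtain x where "x \<in> insert 0 Basis" "v = t + f x"
      using V by blast
    moreover from this(1) have "f x \<in> int_vecs"
      using f(3) Basis_subset_int_vecs int_vecs_zero by blast
    ultimately show "v \<in> int_vecs"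
      using f(4) int_vecs_add by blast
  qed
  have "affine hull (insert 0 Basis :: (real^'n) set) = UNIV"
    by (simp add: affine_hull_span_0 hull_inc span_insert_0)
  moreover have "affine hull V = (+) t ` f ` (affine hull (insert 0 Basis))"
    unfolding V' affine_hull_translation
    by (simp only: affine_hull_linear_image[OF f(1)[unfolded linear_conv_bounded_linear]])
  ultimately show hull: "affine hull V = UNIV"
    using f(2) by (simp add: bij_is_surj)
  \<comment> \<open>Independence by counting: at most n + 1 points that affinely span an
    n-dimensional space are affinely independent.\<close>
  have "card V \<le> card (insert 0 Basis :: (real^'n) set)"
    unfolding V by (rule card_image_le) simp
  also have "\<dots> = DIM(real^'n) + 1"
    by (subst card_insert_disjoint) (auto simp: nonzero_Basis)
  finally have "int (card V) - 1 \<le> aff_dim V"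
    using aff_dim_affine_hull[of V] by (simp add: hull del: aff_dim_affine_hull)
  then show "\<not> affine_dependent V"
    using aff_dim_le_card[OF \<open>finite V\<close>] affine_independent_iff_card[of V] \<open>finite V\<close> by simp
  show "convex hull V \<inter> int_vecs \<subseteq> V"
  proof
    fix w
    assume w: "w \<in> convex hull V \<inter> int_vecs"
    have "convex hull V = (+) t ` f ` (convex hull (insert 0 Basis))"
      unfolding V' convex_hull_translation
      by (simp only: convex_hull_linear_image[OF f(1)])
    then obtain y where y: "y \<in> convex hull (insert 0 Basis)" "w = t + f y"
      using w by auto
    have "f y \<in> int_vecs"
      using w int_vecs_diff[of w t] f(4) y(2) by auto
    then obtain y' where "y' \<in> int_vecs" "f y = f y'"
      using f(3) by (metis imageE)
    then have yint: "y \<in> int_vecs"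
      using f(2) by (metis bij_pointE)
    have y0: "\<And>i. 0 \<le> y $ i" and y1: "(\<Sum>i\<in>UNIV. y $ i) \<le> 1"
    proof -
      have "\<forall>i\<in>Basis. 0 \<le> y \<bullet> i" "(\<Sum>i\<in>Basis. y \<bullet> i) \<le> 1"
        using y(1) by (auto simp: std_simplex)
      moreover have "(\<Sum>i\<in>Basis. y \<bullet> i) = (\<Sum>i\<in>UNIV. y $ i)"
        unfolding Basis_eq_range_axis
        by (subst sum.reindex) (auto simp: inj_on_def axis_eq_axis inner_axis)
      ultimately show "\<And>i. 0 \<le> y $ i" "(\<Sum>i\<in>UNIV. y $ i) \<le> 1"
        by (auto simp: Basis_vec_def inner_axis)
    qed
    have "y = 0 \<or> (\<exists>i. y = axis i 1)"
    proof (rule disjCI)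
      assume "\<nexists>i. y = axis i 1"
      show "y = 0"
      proof (rule ccontr)
        assume "y \<noteq> 0"
        then obtain i where "y $ i \<noteq> 0"
          by (auto simp: vec_eq_iff)
        \<comment> \<open>A nonzero coordinate is a positive integer and already exhausts the bound
          1 on the coordinate sum.\<close>
        then have i: "1 \<le> y $ i"
          using yint y0[of i] Ints_nonzero_abs_ge1[of "y $ i"] by (auto simp: int_vecs_def)
        have "y $ i + (\<Sum>j\<in>UNIV - {i}. y $ j) \<le> 1"
          using y1 by (simp add: sum.remove[of UNIV i])
        moreover have "0 \<le> (\<Sum>j\<in>UNIV - {i}. y $ j)"
          by (simp add: sum_nonneg y0)
        ultimately have "y $ i = 1" "(\<Sum>j\<in>UNIV - {i}. y $ j) = 0"
          using i by auto
        then have "y = axis i 1"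
          using y0 by (auto simp: vec_eq_iff axis_def sum_nonneg_eq_0_iff)
        then show False
          using \<open>\<nexists>i. y = axis i 1\<close> by blast
      qed
    qed
    then show "w \<in> V"
      unfolding y(2) V by (auto simp: Basis_vec_def)
  qed
qed

section \<open>Circumspheres in barycentric coordinates\<close>

definition circumsphere :: "real^'n^'n \<Rightarrow> (real^'n) set \<Rightarrow> real^'n \<Rightarrow> real \<Rightarrow> bool" where
  "circumsphere Q V c r \<longleftrightarrow> (\<forall>v\<in>V. qform Q (v - c) = r)"

text \<open>Here \<open>r\<close> is a squared radius. Quantifying over all circumspheres avoids
  choosing one; the condition has content wherever \<open>circumsphere_exists\<close>
  applies.\<close>

definition outside_sphere :: "real^'n^'n \<Rightarrow> (real^'n) set \<Rightarrow> real^'n \<Rightarrow> bool" where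
  "outside_sphere Q V w \<longleftrightarrow> (\<forall>c r. circumsphere Q V c r \<longrightarrow> r < qform Q (w - c))"

lemma affine_hull_UNIV_weights:
  assumes "finite V" "affine hull V = UNIV"
  obtains \<alpha> where "sum \<alpha> V = 1" "x = (\<Sum>v\<in>V. \<alpha> v *\<^sub>R v)"
proof -
  have "x \<in> affine hull V"
    using assms(2) by simp
  then show thesis
    using that unfolding affine_hull_finite[OF assms(1)] by auto
qed

text \<open>With one vertex moved to the origin, equidistance becomes the linear system (v - v0) . Q
  c = Q[v - v0] / 2. Independence of the differences yields a linear functional with these values,
  and positive definiteness makes \<open>Q\<close> surjective, so the functional is represented by
  some c.\<close>

lemma circumsphere_exists:
  fixes Q :: "real^'n^'n"
  assumes Q: "Q \<in> pqf" and ind: "\<not> affine_dependent V" and "V \<noteq> {}"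
  obtains c r where "circumsphere Q V c r"
proof -
  obtain v0 where v0: "v0 \<in> V"
    using \<open>V \<noteq> {}\<close> by blast
  have ind': "independent ((\<lambda>x. - v0 + x) ` (V - {v0}))"
    using ind affine_dependent_iff_dependent2[OF v0] by blast
  obtain h :: "real^'n \<Rightarrow> real" where h: "linear h"
    "\<And>x. x \<in> (\<lambda>x. - v0 + x) ` (V - {v0}) \<Longrightarrow> h x = qform Q x / 2"
    using linear_independent_extend[OF ind', of "\<lambda>x. qform Q x / 2"] by blast
  have "inj ((*v) Q)"
  proof (rule linear_injective_0[THEN iffD2, rule_format])
    show "x = 0" if "Q *v x = 0" for x
      using pqf_pos[OF Q, of x] that by (auto simp: qform_def)
  qed simp
  then have "surj ((*v) Q)"
    by (simp add: linear_injective_imp_surjective)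
  then obtain c where c: "Q *v c = adjoint h 1"
    by (metis surjD)
  have "qform Q (v - (v0 + c)) = qform Q c" if "v \<in> V" for v
  proof (cases "v = v0")
    case False
    have "(v - v0) \<bullet> (Q *v c) = h (v - v0)"
      unfolding c by (simp add: adjoint_works[OF h(1)])
    also have "\<dots> = qform Q (v - v0) / 2"
      using that False by (intro h(2)) (simp add: image_iff)
    finally show ?thesis
      using qform_diff_scaled[OF pqf_sym[OF Q], of "v - v0" c] by (simp add: algebra_simps)
  qed auto
  then show thesis
    by (intro that[of "v0 + c" "qform Q c"]) (simp add: circumsphere_def)
qed

text \<open>The power Q[x - c] - r equals minus a sum that involves only x, its weights and the
  vertices. It is therefore the same for every circumsphere of \<open>V\<close>.\<close>

lemma circumsphere_power:
  assumes "transpose Q = Q" "finite V" "circumsphere Q V c r"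
    and "sum \<alpha> V = 1" "x = (\<Sum>v\<in>V. \<alpha> v *\<^sub>R v)"
  shows "r = qform Q (x - c) + (\<Sum>v\<in>V. \<alpha> v * qform Q (v - x))"
proof -
  have "(\<Sum>v\<in>V. \<alpha> v * qform Q (v - c)) = (\<Sum>v\<in>V. \<alpha> v * r)"
    by (rule sum.cong[OF refl]) (use assms(3) in \<open>simp add: circumsphere_def\<close>)
  moreover have "\<dots> = r"
    unfolding sum_distrib_right[symmetric] assms(4) by simp
  ultimately show ?thesis
    using qform_weighted_sum[OF assms(1,2,4,5), of c] by linarith
qed

text \<open>The quadratic parts cancel, so a difference of powers is affine in x and equals the
  weighted mean of its values at the vertices of \<open>V\<close>, where the power for the sphere of
  \<open>V\<close> itself is zero.\<close>

lemma circumsphere_power_diff: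
  assumes "transpose Q = Q" "finite V" "circumsphere Q V c r"
    and "sum \<alpha> V = 1" "x = (\<Sum>v\<in>V. \<alpha> v *\<^sub>R v)"
  shows "(qform Q (x - c') - r') - (qform Q (x - c) - r) = (\<Sum>v\<in>V. \<alpha> v * (qform Q (v - c') - r'))"
proof -
  have "(\<Sum>v\<in>V. \<alpha> v * (qform Q (v - c') - r')) = (\<Sum>v\<in>V. \<alpha> v * qform Q (v - c')) - sum \<alpha> V * r'"
    by (simp add: right_diff_distrib sum_subtractf sum_distrib_right)
  then show ?thesis
    using circumsphere_power[OF assms] qform_weighted_sum[OF assms(1,2,4,5), of c'] assms(4) by (simp only: mult_1)
qed

text \<open>Comparison with the sphere of centre 0 and radius 0 removes centre and radius from the
  condition and leaves an inequality linear in \<open>Q\<close> for fixed weights.\<close>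

lemma outside_sphereI:
  assumes "transpose Q = Q" "finite V" "sum \<beta> V = 1" "w = (\<Sum>v\<in>V. \<beta> v *\<^sub>R v)"
    and "(\<Sum>v\<in>V. \<beta> v * qform Q v) < qform Q w"
  shows "outside_sphere Q V w"
  unfolding outside_sphere_def
proof (intro allI impI)
  fix c r
  assume "circumsphere Q V c r"
  from circumsphere_power_diff[OF assms(1,2) this assms(3,4), of 0 0] assms(5)
  show "r < qform Q (w - c)"
    by simp
qed

text \<open>Converse of \<open>outside_sphereI\<close>; the existence of a circumsphere gives the
  universally quantified condition its content.\<close>

lemma outside_sphere_sum_less:
  assumes "Q \<in> pqf" "finite V" "V \<noteq> {}" "\<not> affine_dependent V" "sum \<beta> V = 1" "w = (\<Sum>v\<in>V. \<beta> v *\<^sub>R v)"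
    and "outside_sphere Q V w"
  shows "(\<Sum>v\<in>V. \<beta> v * qform Q v) < qform Q w"
proof -
  obtain c r where c: "circumsphere Q V c r"
    using circumsphere_exists[OF assms(1,4,3)] .
  then show ?thesis
    using circumsphere_power_diff[OF pqf_sym[OF assms(1)] assms(2) c assms(5,6), of 0 0] assms(7)
    by (fastforce simp: outside_sphere_def)
qed

lemma circumsphere_image:
  assumes "linear g" "\<And>x. qform Q (g x) = qform Q x"
  shows "circumsphere Q ((\<lambda>x. t + g x) ` V) (t + g c) r \<longleftrightarrow> circumsphere Q V c r"
proof -
  have "qform Q ((t + g v) - (t + g c)) = qform Q (v - c)" for v
    by (metis add_diff_cancel_left assms linear_diff)
  then show ?thesis
    by (simp add: circumsphere_def)
qed

lemma outside_sphere_image: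
  assumes "linear g" "bij g" "\<And>x. qform Q (g x) = qform Q x" "outside_sphere Q V w"
  shows "outside_sphere Q ((\<lambda>x. t + g x) ` V) (t + g w)"
  unfolding outside_sphere_def
proof (intro allI impI)
  fix c r
  assume *: "circumsphere Q ((\<lambda>x. t + g x) ` V) c r"
  obtain c' where "c - t = g c'"
    using \<open>bij g\<close> by (metis bij_pointE)
  then have c: "c = t + g c'"
    by (simp add: algebra_simps)
  have "r < qform Q (w - c')"
    using * assms(4) circumsphere_image[OF assms(1,3)] unfolding outside_sphere_def c by blast
  also have "\<dots> = qform Q (t + g w - c)"
    by (metis (no_types) add_diff_cancel_left assms(1,3) c linear_diff)
  finally show "r < qform Q (t + g w - c)" .
qed

lemma outside_sphere_translate:
  "outside_sphere Q V w \<Longrightarrow> outside_sphere Q ((+) t ` V) (t + w)"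
  using outside_sphere_image[of id Q V w t] by (simp add: linear_id)

section \<open>Locally regular lattice triangulations\<close>

locale simplex_family =
  fixes F :: "(real^'n) set set"
  assumes finite_F: "finite F" and F_nonempty: "F \<noteq> {}"
    and unimodular_F: "V \<in> F \<Longrightarrow> unimodular_simplex V"
begin

definition cells :: "(real^'n) set set" where
  "cells = (\<Union>V\<in>F. (\<lambda>t. (+) t ` V) ` int_vecs)"

text \<open>Voronoi's local criterion, imposed on \<open>F\<close> and extended to all translates by
  \<open>regular_cells\<close>. Strictness keeps neighbouring cells from merging into one Delone
  polytope.\<close>

definition regular :: "real^'n^'n \<Rightarrow> bool" where
  "regular Q \<longleftrightarrow> (\<forall>V\<in>F. \<forall>v\<in>V. \<exists>W\<in>cells. V - {v} \<subseteq> W \<and> outside_sphere Q W v)"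

lemma unimodular_cells: "V \<in> cells \<Longrightarrow> unimodular_simplex V"
  by (auto simp: cells_def intro: unimodular_simplex_translation unimodular_F)

lemma cells_translate: "V \<in> cells \<Longrightarrow> t \<in> int_vecs \<Longrightarrow> (+) t ` V \<in> cells"
proof -
  assume "V \<in> cells" and t: "t \<in> int_vecs"
  then obtain U s where U: "U \<in> F" "s \<in> int_vecs" "V = (+) s ` U"
    by (auto simp: cells_def)
  have "(+) t ` V = (+) (t + s) ` U"
    by (simp add: U(3) image_image add.assoc)
  then show ?thesis
    unfolding cells_def
    by (intro UN_I[OF U(1)] image_eqI[of _ _ "t + s"] int_vecs_add t U(2))
qed

lemma F_subset_cells: "V \<in> F \<Longrightarrow> V \<in> cells"
  unfolding cells_def by (intro UN_I[of V] image_eqI[of _ _ 0]) auto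

lemma regular_cells:
  assumes "regular Q" "V \<in> cells" "v \<in> V"
  obtains W where "W \<in> cells" "V - {v} \<subseteq> W" "outside_sphere Q W v"
proof -
  obtain U s where U: "U \<in> F" "s \<in> int_vecs" "V = (+) s ` U"
    using assms(2) by (auto simp: cells_def)
  obtain u where u: "u \<in> U" "v = s + u"
    using assms(3) U(3) by auto
  obtain W where W: "W \<in> cells" "U - {u} \<subseteq> W" "outside_sphere Q W u"
    using assms(1) U(1) u(1) unfolding regular_def by blast
  have "V - {v} \<subseteq> (+) s ` W"
    using W(2) unfolding U(3) u(2) by auto
  then show thesis
    using that W U(2) u(2) cells_translate outside_sphere_translate by blast
qed

lemma cells_circumsphere:
  assumes "Q \<in> pqf" "V \<in> cells"
  obtains c r where "circumsphere Q V c r"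
  using circumsphere_exists[OF assms(1)] unimodular_cells[OF assms(2)]
    unimodular_simplex_affine_independent unimodular_simplex_nonempty by blast

text \<open>Equivalently, among all cells the affine interpolant of \<open>Q\<close> on
  \<open>V\<close> is largest at x: the cells are read off from an upper envelope of affine
  functions.\<close>

definition power_minimal :: "real^'n^'n \<Rightarrow> real^'n \<Rightarrow> (real^'n) set \<Rightarrow> bool" where
  "power_minimal Q x V \<longleftrightarrow> V \<in> cells \<and>
     (\<forall>W\<in>cells. \<forall>c r c' r'. circumsphere Q V c r \<longrightarrow> circumsphere Q W c' r' \<longrightarrow>
        qform Q (x - c) - r \<le> qform Q (x - c') - r')"

lemma circumsphere_unique_power:
  assumes "Q \<in> pqf" "V \<in> cells" "circumsphere Q V c r" "circumsphere Q V c' r'"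
  shows "qform Q (x - c) - r = qform Q (x - c') - r'"
proof -
  note V = unimodular_cells[OF assms(2)]
  obtain \<alpha> where \<alpha>: "sum \<alpha> V = 1" "x = (\<Sum>v\<in>V. \<alpha> v *\<^sub>R v)"
    using affine_hull_UNIV_weights[OF unimodular_simplex_finite[OF V] unimodular_simplex_affine_hull[OF V]] .
  show ?thesis
    using circumsphere_power[OF pqf_sym[OF assms(1)] unimodular_simplex_finite[OF V] assms(3) \<alpha>]
      circumsphere_power[OF pqf_sym[OF assms(1)] unimodular_simplex_finite[OF V] assms(4) \<alpha>] by linarith
qed

text \<open>Translating a simplex translates its centre, so only finitely many translates of the
  finitely many members of \<open>F\<close> have power at most that of a fixed cell.
  \<open>P\<close> is the power of x for a translated simplex.\<close>

lemma power_minimal_exists: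
  assumes Q: "Q \<in> pqf"
  obtains V where "power_minimal Q x V"
proof -
  have "\<exists>c r. circumsphere Q V c r" if "V \<in> F" for V
    using cells_circumsphere[OF Q F_subset_cells[OF that]] by blast
  then obtain c r where cr: "\<And>V. V \<in> F \<Longrightarrow> circumsphere Q V (c V) (r V)"
    by metis
  define P where "P = (\<lambda>(V, t). qform Q (x - (t + c V)) - r V)"
  have tr: "circumsphere Q ((+) t ` V) (t + c V) (r V)" if "V \<in> F" for V t
    using circumsphere_image[of id Q t V "c V" "r V"] cr[OF that] by (simp add: linear_id)
  obtain V0 where V0: "V0 \<in> F"
    using F_nonempty by blast
  define A where "A = {p \<in> F \<times> int_vecs. P p \<le> P (V0, 0)}"
  have "A \<subseteq> Sigma F (\<lambda>V. {t \<in> int_vecs. qform Q (t - (x - c V)) \<le> P (V0, 0) + r V})"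
    unfolding A_def P_def by (auto simp: algebra_simps qform_minus_commute[of Q x])
  moreover have "finite (Sigma F (\<lambda>V. {t \<in> int_vecs. qform Q (t - (x - c V)) \<le> P (V0, 0) + r V}))"
    by (intro finite_SigmaI finite_F finite_int_vecs_qform_le Q)
  ultimately have "finite A"
    by (rule finite_subset)
  moreover have A0: "(V0, 0) \<in> A"
    by (simp add: A_def V0)
  ultimately obtain p where p: "p \<in> A" "\<And>p'. p' \<in> A \<Longrightarrow> P p \<le> P p'"
    by (metis arg_min_if_finite(1) arg_min_least empty_iff)
  obtain V t where Vt: "p = (V, t)" "V \<in> F" "t \<in> int_vecs"
    using p(1) by (auto simp: A_def)
  have min: "P (V, t) \<le> P (W, s)" if "W \<in> F" "s \<in> int_vecs" for W s
    using p(2)[of "(W, s)"] p(2)[OF A0] that Vt(1) by (cases "(W, s) \<in> A") (auto simp: A_def)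
  have cell: "(+) t ` V \<in> cells"
    using Vt by (auto simp: cells_def)
  have "power_minimal Q x ((+) t ` V)"
    unfolding power_minimal_def
  proof (intro conjI ballI allI impI cell)
    fix W' c1 r1 c2 r2
    assume W': "W' \<in> cells" and 1: "circumsphere Q ((+) t ` V) c1 r1" and 2: "circumsphere Q W' c2 r2"
    obtain W s where Ws: "W \<in> F" "s \<in> int_vecs" "W' = (+) s ` W"
      using W' by (auto simp: cells_def)
    have "qform Q (x - c1) - r1 = P (V, t)"
      using circumsphere_unique_power[OF Q cell 1 tr[OF Vt(2)]] by (simp add: P_def)
    also have "\<dots> \<le> P (W, s)"
      using min Ws by blast
    also have "\<dots> = qform Q (x - c2) - r2"
      using circumsphere_unique_power[OF Q W' 2 tr[OF Ws(1), of s, folded Ws(3)]] by (simp add: P_def)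
    finally show "qform Q (x - c1) - r1 \<le> qform Q (x - c2) - r2" .
  qed
  then show thesis
    using that by blast
qed

text \<open>Crossing a facet beyond which \<open>x\<close> lies strictly decreases the power of \<open>x\<close>.\<close>

lemma power_minimal_convex_hull:
  assumes Q: "Q \<in> pqf" and reg: "regular Q" and min: "power_minimal Q x V"
  shows "x \<in> convex hull V"
proof -
  have V: "V \<in> cells" "unimodular_simplex V"
    using min unimodular_cells by (auto simp: power_minimal_def)
  have fin: "finite V"
    using V(2) by (rule unimodular_simplex_finite)
  obtain \<alpha> where \<alpha>: "sum \<alpha> V = 1" "x = (\<Sum>v\<in>V. \<alpha> v *\<^sub>R v)"
    using affine_hull_UNIV_weights[OF fin unimodular_simplex_affine_hull[OF V(2)]] .
  have "0 \<le> \<alpha> v" if v: "v \<in> V" for v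
  proof (rule ccontr)
    assume neg: "\<not> 0 \<le> \<alpha> v"
    obtain W where W: "W \<in> cells" "V - {v} \<subseteq> W" "outside_sphere Q W v"
      using regular_cells[OF reg V(1) v] .
    obtain c r where c: "circumsphere Q V c r"
      using cells_circumsphere[OF Q V(1)] .
    obtain c' r' where c': "circumsphere Q W c' r'"
      using cells_circumsphere[OF Q W(1)] .
    have "(qform Q (x - c') - r') - (qform Q (x - c) - r) = (\<Sum>u\<in>V. \<alpha> u * (qform Q (u - c') - r'))"
      by (rule circumsphere_power_diff[OF pqf_sym[OF Q] fin c \<alpha>])
    also have "\<dots> = \<alpha> v * (qform Q (v - c') - r') + (\<Sum>u\<in>V-{v}. \<alpha> u * (qform Q (u - c') - r'))"
      by (rule sum.remove[OF fin v])
    \<comment> \<open>The other vertices lie on the sphere of \<open>W\<close>, so the change of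
      power is the negative weight of v times its positive power.\<close>
    also have "(\<Sum>u\<in>V-{v}. \<alpha> u * (qform Q (u - c') - r')) = 0"
      using W(2) c' by (intro sum.neutral) (auto simp: circumsphere_def)
    also have "\<alpha> v * (qform Q (v - c') - r') + 0 < 0"
      using W(3) c' neg by (auto simp: outside_sphere_def mult_less_0_iff)
    finally have "qform Q (x - c') - r' < qform Q (x - c) - r"
      by simp
    then show False
      using min W(1) c c' unfolding power_minimal_def by (meson not_less)
  qed
  then show ?thesis
    unfolding convex_hull_finite[OF fin] using \<alpha> by auto
qed

text \<open>A cell of least power at a lattice point w contains w in its hull, hence as a vertex, so
  the least power at w is 0 and all powers at w are nonnegative. If \<open>V\<close> has power 0 at
  w, then \<open>V\<close> is minimal as well and the same argument puts w into
  \<open>V\<close>.\<close>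

lemma empty_circumsphere:
  assumes Q: "Q \<in> pqf" and reg: "regular Q" and V: "V \<in> cells" and c: "circumsphere Q V c r"
    and w: "w \<in> int_vecs"
  shows "r \<le> qform Q (w - c)" and "qform Q (w - c) = r \<Longrightarrow> w \<in> V"
proof -
  obtain W where W: "power_minimal Q w W"
    using power_minimal_exists[OF Q] .
  then have W': "W \<in> cells"
    by (simp add: power_minimal_def)
  obtain c' r' where c': "circumsphere Q W c' r'"
    using cells_circumsphere[OF Q W'] .
  have in_cell: "w \<in> U" if "power_minimal Q w U" for U
    using power_minimal_convex_hull[OF Q reg that] unimodular_simplex_lattice_points[of U] w
      that unimodular_cells[of U] by (auto simp: power_minimal_def)
  have 0: "qform Q (w - c') - r' = 0"
    using in_cell[OF W] c' by (simp add: circumsphere_def)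
  then show "r \<le> qform Q (w - c)"
    using W V c c' unfolding power_minimal_def by fastforce
  show "w \<in> V" if eq: "qform Q (w - c) = r"
  proof (rule in_cell)
    show "power_minimal Q w V"
      unfolding power_minimal_def
    proof (intro conjI V ballI allI impI)
      fix U c1 r1 c2 r2
      assume U: "U \<in> cells" and 1: "circumsphere Q V c1 r1" and 2: "circumsphere Q U c2 r2"
      have "qform Q (w - c1) - r1 = qform Q (w - c') - r'"
        using circumsphere_unique_power[OF Q V 1 c, of w] eq 0 by simp
      also have "\<dots> \<le> qform Q (w - c2) - r2"
        using W U c' 2 unfolding power_minimal_def by blast
      finally show "qform Q (w - c1) - r1 \<le> qform Q (w - c2) - r2" .
    qed
  qed
qed

text \<open>Let \<open>W\<close> have least power at the barycentre x of \<open>V\<close>. Emptiness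
  of the given sphere, tested at the vertices of \<open>W\<close>, and emptiness of the sphere of
  \<open>W\<close>, tested on \<open>V\<close>, compare the two powers of x in opposite directions.
  Equality with strictly positive weights puts every point of \<open>V\<close> on the sphere of
  \<open>W\<close>.\<close>

lemma subset_cell_of_empty_sphere:
  assumes Q: "Q \<in> pqf" and reg: "regular Q" and V: "finite V" "V \<noteq> {}" "V \<subseteq> int_vecs"
    and on: "\<And>v. v \<in> V \<Longrightarrow> qform Q (v - c) = r" and off: "\<And>v. v \<in> int_vecs \<Longrightarrow> r \<le> qform Q (v - c)"
  obtains W where "W \<in> cells" "V \<subseteq> W"
proof -
  define k where "k = 1 / real (card V)"
  define x where "x = (\<Sum>v\<in>V. k *\<^sub>R v)"
  have k: "k > 0" "(\<Sum>v\<in>V. k) = 1"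
    using V(1,2) by (auto simp: k_def card_gt_0_iff)
  obtain W where min: "power_minimal Q x W"
    using power_minimal_exists[OF Q] .
  then have W: "W \<in> cells" "unimodular_simplex W"
    using unimodular_cells by (auto simp: power_minimal_def)
  have finW: "finite W"
    using W(2) by (rule unimodular_simplex_finite)
  obtain c' r' where c': "circumsphere Q W c' r'"
    using cells_circumsphere[OF Q W(1)] .
  obtain \<alpha> where \<alpha>: "\<And>u. u \<in> W \<Longrightarrow> 0 \<le> \<alpha> u" "sum \<alpha> W = 1" "x = (\<Sum>u\<in>W. \<alpha> u *\<^sub>R u)"
    using power_minimal_convex_hull[OF Q reg min] unfolding convex_hull_finite[OF finW] by auto
  have "0 \<le> (\<Sum>u\<in>W. \<alpha> u * (qform Q (u - c) - r))"
    using \<alpha>(1) off unimodular_simplex_int[OF W(2)] by (intro sum_nonneg mult_nonneg_nonneg) fastforce+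
  then have "0 \<le> (qform Q (x - c) - r) - (qform Q (x - c') - r')"
    by (simp only: circumsphere_power_diff[OF pqf_sym[OF Q] finW c' \<alpha>(2,3)])
  moreover have "(qform Q (x - c') - r') - (qform Q (x - c) - r) = (\<Sum>v\<in>V. k * (qform Q (v - c') - r'))"
    using on k(2) x_def by (intro circumsphere_power_diff[OF pqf_sym[OF Q] V(1)]) (auto simp: circumsphere_def)
  ultimately have "(\<Sum>v\<in>V. k * (qform Q (v - c') - r')) \<le> 0"
    by linarith
  moreover have nonneg: "0 \<le> k * (qform Q (v - c') - r')" if "v \<in> V" for v
    using empty_circumsphere(1)[OF Q reg W(1) c', of v] that V(3) k(1) by auto
  ultimately have "(\<Sum>v\<in>V. k * (qform Q (v - c') - r')) = 0"
    by (intro antisym sum_nonneg)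
  then have "\<forall>v\<in>V. k * (qform Q (v - c') - r') = 0"
    by (subst (asm) sum_nonneg_eq_0_iff[OF V(1) nonneg])
  then have "V \<subseteq> W"
    using empty_circumsphere(2)[OF Q reg W(1) c'] V(3) k(1) by auto
  then show thesis
    using that W(1) by blast
qed

text \<open>For a face \<open>V\<close> of a cell \<open>W\<close>, the average of the affine functions interpolating \<open>Q\<close> on
  \<open>W\<close> and on its neighbours across the facets containing \<open>V\<close> supports \<open>Q\<close> exactly on \<open>V\<close>.\<close>

lemma face_delone_polytope:
  assumes Q: "Q \<in> pqf" and reg: "regular Q" and W: "W \<in> cells" and V: "V \<subseteq> W" "V \<noteq> {}"
  shows "delone_polytope Q (convex hull V)"
proof -
  have sym: "transpose Q = Q"
    using Q by (rule pqf_sym)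
  have finW: "finite W" and Wint: "W \<subseteq> int_vecs"
    using unimodular_cells[OF W] by (simp_all add: unimodular_simplex_finite unimodular_simplex_int)
  have "\<exists>U. U \<in> cells \<and> V \<subseteq> U \<and> (w \<in> W - V \<longrightarrow> w \<notin> U)" for w
  proof (cases "w \<in> W - V")
    case True
    obtain U where U: "U \<in> cells" "W - {w} \<subseteq> U" "outside_sphere Q U w"
      using regular_cells[OF reg W] True by blast
    obtain c r where c: "circumsphere Q U c r"
      using cells_circumsphere[OF Q U(1)] .
    then have "r < qform Q (w - c)"
      using U(3) by (simp add: outside_sphere_def)
    then have "w \<notin> U"
      using c by (auto simp: circumsphere_def)
    then show ?thesis
      using U(1,2) True V(1) by blast
  qed (use W V in blast)
  then obtain U where U: "\<And>w. U w \<in> cells" "\<And>w. V \<subseteq> U w" "\<And>w. w \<in> W - V \<Longrightarrow> w \<notin> U w"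
    by metis
  \<comment> \<open>Each w in \<open>W - V\<close> has a cell \<open>U w\<close> that contains
    \<open>V\<close> but omits w, so the cells in \<open>N\<close> have exactly \<open>V\<close> in
    common.\<close>
  define N where "N = insert W (U ` (W - V))"
  have N: "finite N" "N \<noteq> {}" "\<And>U. U \<in> N \<Longrightarrow> U \<in> cells" "\<And>U. U \<in> N \<Longrightarrow> V \<subseteq> U"
    using finW W V(1) U(1,2) by (auto simp: N_def)
  have N_Inter: "\<Inter>N \<subseteq> V"
  proof
    fix x
    assume x: "x \<in> \<Inter>N"
    show "x \<in> V"
    proof (rule ccontr)
      assume "x \<notin> V"
      then have "x \<in> W - V"
        using x by (simp add: N_def)
      then show False
        using x U(3)[of x] by (simp add: N_def)
    qed
  qed
  have "\<exists>c r. circumsphere Q U c r" if "U \<in> N" for U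
    using cells_circumsphere[OF Q N(3)[OF that]] by blast
  then obtain c r where c: "\<And>U. U \<in> N \<Longrightarrow> circumsphere Q U (c U) (r U)"
    by metis
  define k where "k = 1 / real (card N)"
  have k: "k > 0" "(\<Sum>U\<in>N. k) = 1"
    using N(1,2) by (auto simp: k_def card_gt_0_iff)
  define z where "z = (\<Sum>U\<in>N. k *\<^sub>R c U)"
  define P where "P x = (\<Sum>U\<in>N. k * (qform Q (x - c U) - r U))" for x
  define K where "K = qform Q z - P 0"
  \<comment> \<open>All powers share the quadratic part Q[x]; a mean with total weight 1 is again
    the power for a single sphere, centred at the mean of the centres.\<close>
  have P: "P x = qform Q (x - z) - K" for x
  proof -
    have *: "qform Q (y - c U) - r U = qform Q y - 2 * (y \<bullet> (Q *v c U)) + qform Q (c U) - r U" for U y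
      using qform_diff_scaled[OF sym] by simp
    have "P x - P 0 = (\<Sum>U\<in>N. k * qform Q x - 2 * (x \<bullet> (Q *v (k *\<^sub>R c U))))"
      unfolding P_def * sum_subtractf[symmetric]
      by (intro sum.cong refl) (simp add: algebra_simps matrix_vector_mult_scaleR)
    also have "\<dots> = (\<Sum>U\<in>N. k) * qform Q x - 2 * (x \<bullet> (Q *v z))"
      by (simp add: sum_subtractf sum_distrib_left sum_distrib_right z_def linear_sum[OF matrix_vector_mul_linear] inner_sum_right)
    finally show ?thesis
      using qform_diff_scaled[OF sym, of x z] unfolding k(2) K_def by linarith
  qed
  have Pv: "P v = 0" if "v \<in> V" for v
    unfolding P_def using c N(4) that by (intro sum.neutral) (auto simp: circumsphere_def)
  have Ppos: "0 < P w" if w: "w \<in> int_vecs - V" for w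
  proof -
    have nn: "0 \<le> k * (qform Q (w - c U) - r U)" if "U \<in> N" for U
      using empty_circumsphere(1)[OF Q reg N(3)[OF that] c[OF that], of w] w k(1) by simp
    obtain U where UN: "U \<in> N" "w \<notin> U"
      using w N_Inter by blast
    have "qform Q (w - c U) - r U \<noteq> 0"
      using empty_circumsphere(2)[OF Q reg N(3)[OF UN(1)] c[OF UN(1)], of w] w UN(2) by auto
    then have "0 < k * (qform Q (w - c U) - r U)"
      using nn[OF UN(1)] k(1) by (simp add: less_le)
    then show ?thesis
      unfolding P_def by (intro sum_pos2[OF N(1) UN(1)] nn)
  qed
  obtain v where "v \<in> V"
    using V(2) by blast
  then have "K = qform Q (v - z)"
    using Pv P by simp
  then have "0 \<le> K"
    by (simp add: pqf_nonneg[OF Q])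
  have "finite V" "V \<subseteq> int_vecs"
    using V(1) finW Wint finite_subset by auto
  moreover have "\<forall>v\<in>V. qform Q (v - z) = (sqrt K)\<^sup>2"
    using Pv P \<open>0 \<le> K\<close> by simp
  moreover have "\<forall>v\<in>int_vecs - V. qform Q (v - z) > (sqrt K)\<^sup>2"
    using Ppos P \<open>0 \<le> K\<close> by simp
  ultimately show ?thesis
    unfolding delone_polytope_def using V(2) by blast
qed

text \<open>The right-hand side does not mention \<open>Q\<close>: all positive definite forms for
  which the family is regular have the same Delone subdivision.\<close>

lemma Del_eq:
  assumes "Q \<in> pqf" "regular Q"
  shows "Del Q = {convex hull V |V W. W \<in> cells \<and> V \<subseteq> W \<and> V \<noteq> {}}"
proof (intro equalityI subsetI)
  fix P
  assume "P \<in> Del Q"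
  then obtain V c r where V: "finite V" "V \<noteq> {}" "V \<subseteq> int_vecs" "P = convex hull V"
    and on: "\<forall>v\<in>V. qform Q (v - c) = r\<^sup>2" and off: "\<forall>v\<in>int_vecs - V. qform Q (v - c) > r\<^sup>2"
    unfolding Del_def delone_polytope_def by blast
  obtain W where "W \<in> cells" "V \<subseteq> W"
    using subset_cell_of_empty_sphere[OF assms V(1-3), of c "r\<^sup>2"] on off
    by (metis DiffI less_imp_le order_refl)
  then show "P \<in> {convex hull V |V W. W \<in> cells \<and> V \<subseteq> W \<and> V \<noteq> {}}"
    using V by blast
next
  fix P
  assume "P \<in> {convex hull V |V W. W \<in> cells \<and> V \<subseteq> W \<and> V \<noteq> {}}"
  then show "P \<in> Del Q"
    unfolding Del_def using face_delone_polytope[OF assms] by blast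
qed

lemma triangulation_Del:
  assumes "Q \<in> pqf" "regular Q"
  shows "triangulation (Del Q)"
  unfolding triangulation_def Del_eq[OF assms]
proof
  fix P
  assume "P \<in> {convex hull V |V W. W \<in> cells \<and> V \<subseteq> W \<and> V \<noteq> {}}"
  then obtain V W where V: "P = convex hull V" "W \<in> cells" "V \<subseteq> W"
    by blast
  then have "\<not> affine_dependent V"
    using affine_independent_subset unimodular_simplex_affine_independent unimodular_cells by blast
  then show "\<exists>k. k simplex P"
    unfolding simplex_def V(1) by (intro exI[of _ "int (card V) - 1"] exI[of _ V]) auto
qed

text \<open>A shortest lattice vector is an edge of the triangulation: the sphere around its midpoint
  through its end points is empty.\<close>

lemma packing_lambda_ge_edges:
  assumes Q: "Q \<in> pqf" and reg: "regular Q"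
    and edges: "\<And>V u v. V \<in> F \<Longrightarrow> u \<in> V \<Longrightarrow> v \<in> V \<Longrightarrow> u \<noteq> v \<Longrightarrow> l \<le> qform Q (u - v)"
  shows "l \<le> packing_lambda Q"
proof (rule packing_lambda_ge)
  fix v0 :: "real^'n"
  assume v0: "v0 \<in> int_vecs" "v0 \<noteq> 0"
  define A where "A = {v \<in> int_vecs - {0}. qform Q v \<le> qform Q v0}"
  have "finite A"
    by (rule finite_subset[OF _ finite_int_vecs_qform_le[OF Q, of 0 "qform Q v0"]]) (auto simp: A_def)
  moreover have "v0 \<in> A"
    using v0 by (simp add: A_def)
  ultimately obtain w where w: "w \<in> A" "\<And>v. v \<in> A \<Longrightarrow> qform Q w \<le> qform Q v"
    by (metis arg_min_if_finite(1) arg_min_least empty_iff)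
  have min: "qform Q w \<le> qform Q v" if "v \<in> int_vecs" "v \<noteq> 0" for v
    using w(2)[of v] w that by (cases "v \<in> A") (auto simp: A_def)
  have w': "w \<in> int_vecs" "w \<noteq> 0"
    using w(1) by (auto simp: A_def)
  have half: "qform Q ((1/2) *\<^sub>R w) = qform Q w / 4"
    by (simp add: power2_eq_square)
  have eq: "w - (1/2) *\<^sub>R w = (1/2) *\<^sub>R w"
    by (simp add: vec_eq_iff)
  have on: "qform Q (v - (1/2) *\<^sub>R w) = qform Q w / 4" if "v \<in> {0, w}" for v
    using that by (auto simp only: insert_iff empty_iff eq half diff_0 qform_minus)
  have off: "qform Q w / 4 \<le> qform Q (v - (1/2) *\<^sub>R w)" if v: "v \<in> int_vecs" for v
  proof (cases "v = 0 \<or> v = w")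
    case True
    then show ?thesis
      using on[of v] by auto
  next
    case False
    have "v - (1/2) *\<^sub>R w - (1/2) *\<^sub>R w = v - w"
      by (simp add: vec_eq_iff)
    \<comment> \<open>The parallelogram law with v and v - w both at least as long as w gives
      Q[v - w/2] >= 3/4 Q[w], more than the required quarter.\<close>
    then have "qform Q v + qform Q (v - w) = 2 * qform Q (v - (1/2) *\<^sub>R w) + 2 * qform Q ((1/2) *\<^sub>R w)"
      by (metis diff_add_cancel parallelogram_qform[OF pqf_sym[OF Q]])
    moreover have "qform Q w \<le> qform Q v"
      using False by (intro min v) simp
    moreover have "qform Q w \<le> qform Q (v - w)"
      using False by (intro min int_vecs_diff v w'(1)) simp
    ultimately show ?thesis
      using half pqf_nonneg[OF Q, of w] by linarith
  qed
  obtain W where W: "W \<in> cells" "{0, w} \<subseteq> W"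
    using subset_cell_of_empty_sphere[OF Q reg, of "{0, w}" "(1/2) *\<^sub>R w" "qform Q w / 4"] w' on off
    by (metis empty_subsetI finite.emptyI finite.insertI insert_not_empty insert_subset int_vecs_zero)
  then obtain V t where V: "V \<in> F" "W = (+) t ` V"
    by (auto simp: cells_def)
  then obtain a b where "a \<in> V" "0 = t + a" "b \<in> V" "w = t + b"
    using W(2) by auto
  then have "l \<le> qform Q (b - a)"
    using edges[OF V(1)] w'(2) by metis
  also have "b - a = w"
    using \<open>0 = t + a\<close> \<open>w = t + b\<close> by (metis add_diff_cancel_left diff_zero)
  finally show "l \<le> qform Q v0"
    using min[OF v0] by linarith
qed

text \<open>The centre of the ball may be any point. For x in the hull of a cell, the weighted mean
  of Q[v - x] is at most that of Q[v - p], since x is the weighted mean of the vertices; so some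
  vertex is within m of x. This allows approximate circumcentres.\<close>

lemma covering_mu_le_cells:
  assumes Q: "Q \<in> pqf" and reg: "regular Q"
    and balls: "\<And>V. V \<in> F \<Longrightarrow> \<exists>p. \<forall>v\<in>V. qform Q (v - p) \<le> m"
  shows "covering_mu Q \<le> m"
proof (rule covering_mu_le[OF Q])
  fix x :: "real^'n"
  obtain W where min: "power_minimal Q x W"
    using power_minimal_exists[OF Q] .
  then have W: "W \<in> cells" "unimodular_simplex W"
    using unimodular_cells by (auto simp: power_minimal_def)
  have finW: "finite W"
    using W(2) by (rule unimodular_simplex_finite)
  obtain \<alpha> where \<alpha>: "\<And>u. u \<in> W \<Longrightarrow> 0 \<le> \<alpha> u" "sum \<alpha> W = 1" "x = (\<Sum>u\<in>W. \<alpha> u *\<^sub>R u)"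
    using power_minimal_convex_hull[OF Q reg min] unfolding convex_hull_finite[OF finW] by auto
  obtain V t where V: "V \<in> F" "W = (+) t ` V"
    using W(1) by (auto simp: cells_def)
  obtain p0 where "\<forall>v\<in>V. qform Q (v - p0) \<le> m"
    using balls[OF V(1)] by blast
  then have p: "qform Q (v - (t + p0)) \<le> m" if "v \<in> W" for v
    using that V(2) by auto
  show "\<exists>v\<in>int_vecs. qform Q (x - v) \<le> m"
  proof (rule ccontr)
    assume "\<not> ?thesis"
    then have gt: "m < qform Q (v - x)" if "v \<in> W" for v
      using that unimodular_simplex_int[OF W(2)] by (metis not_le qform_minus_commute subsetD)
    have "(\<Sum>v\<in>W. \<alpha> v * m) < (\<Sum>v\<in>W. \<alpha> v * qform Q (v - x))"
    proof (rule sum_strict_mono_ex1[OF finW])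
      show "\<forall>v\<in>W. \<alpha> v * m \<le> \<alpha> v * qform Q (v - x)"
        using \<alpha>(1) gt by (auto intro!: mult_left_mono simp: less_imp_le)
      obtain u where "u \<in> W" "\<alpha> u \<noteq> 0"
        using \<alpha>(2) by (metis sum.neutral zero_neq_one)
      then show "\<exists>v\<in>W. \<alpha> v * m < \<alpha> v * qform Q (v - x)"
        using \<alpha>(1)[of u] gt[of u] by (intro bexI[of _ u]) auto
    qed
    also have "\<dots> \<le> (\<Sum>v\<in>W. \<alpha> v * qform Q (v - (t + p0)))"
      using qform_weighted_sum[OF pqf_sym[OF Q] finW \<alpha>(2,3), of "t + p0"] pqf_nonneg[OF Q, of "x - (t + p0)"]
      by linarith
    also have "\<dots> \<le> (\<Sum>v\<in>W. \<alpha> v * m)"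
      using \<alpha>(1) p by (intro sum_mono mult_left_mono)
    finally show False
      by simp
  qed
qed

text \<open>The right-hand side is a lower bound linear in the form, with equality when the point
  \<open>x\<close> is the circumcentre.\<close>

lemma covering_mu_ge_cell:
  assumes Q: "Q \<in> pqf" and reg: "regular Q" and W: "W \<in> cells"
    and \<alpha>: "sum \<alpha> W = 1" "x = (\<Sum>v\<in>W. \<alpha> v *\<^sub>R v)"
  shows "(\<Sum>v\<in>W. \<alpha> v * qform Q (v - x)) \<le> covering_mu Q"
proof -
  obtain c r where c: "circumsphere Q W c r"
    using cells_circumsphere[OF Q W] .
  have "(\<Sum>v\<in>W. \<alpha> v * qform Q (v - x)) \<le> r"
    using circumsphere_power[OF pqf_sym[OF Q] unimodular_simplex_finite[OF unimodular_cells[OF W]] c \<alpha>]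
      pqf_nonneg[OF Q, of "x - c"] by linarith
  also have "r \<le> covering_mu Q"
    using empty_circumsphere(1)[OF Q reg W c] by (intro covering_mu_ge[OF Q])
  finally show ?thesis .
qed

end

section \<open>Stability under small changes of the form\<close>

lemma linear_qform_matrix: "linear (\<lambda>Q. qform Q x)"
  by (rule linearI) (simp_all add: qform_add_matrix qform_scaleR_matrix)

text \<open>The coercivity constant of \<open>Q\<close> absorbs the perturbation, which changes the
  form at x by at most n^2 |Q' - Q| |x|^2.\<close>

lemma eventually_pqf:
  fixes Q :: "real^'n^'n"
  assumes "Q \<in> pqf"
  shows "\<forall>\<^sub>F Q' in nhds Q. transpose Q' = Q' \<longrightarrow> Q' \<in> pqf"
proof -
  obtain a where a: "a > 0" "\<And>x. a * (norm x)\<^sup>2 \<le> qform Q x"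
    using pqf_coercive[OF assms] by blast
  define n where "n = real CARD('n)"
  have n: "n > 0"
    by (simp add: n_def)
  have bound: "\<bar>qform A x\<bar> \<le> n * n * norm A * (norm x)\<^sup>2" for A :: "real^'n^'n" and x
  proof -
    have "\<bar>A $ i $ j\<bar> \<le> norm A" for i j
      using component_le_norm_cart[of "A $ i" j] Finite_Cartesian_Product.norm_nth_le[of A i] by linarith
    then have "onorm ((*v) A) \<le> n * n * norm A"
      unfolding n_def by (rule onorm_le_matrix_component)
    then have "norm (A *v x) \<le> n * n * norm A * norm x"
      using onorm[OF matrix_vector_mul_bounded_linear, of A x] by (meson mult_right_mono norm_ge_zero order_trans)
    then have "norm x * norm (A *v x) \<le> norm x * (n * n * norm A * norm x)"
      by (rule mult_left_mono) simp
    then show ?thesis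
      using Cauchy_Schwarz_ineq2[of x "A *v x"] unfolding qform_def power2_eq_square by (simp add: mult_ac)
  qed
  have "Q' \<in> pqf" if near: "dist Q' Q < a / (n * n)" and sym: "transpose Q' = Q'" for Q'
  proof -
    have "0 < qform Q' x" if "x \<noteq> 0" for x
    proof -
      have "n * n * norm (Q' - Q) < a"
        using near n by (simp add: dist_norm field_simps)
      then have "n * n * norm (Q' - Q) * (norm x)\<^sup>2 < a * (norm x)\<^sup>2"
        using that by simp
      moreover have "qform Q' x = qform Q x + qform (Q' - Q) x"
        by (simp flip: qform_add_matrix)
      ultimately show ?thesis
        using bound[of "Q' - Q" x] a(2)[of x] by linarith
    qed
    then show ?thesis
      using sym by (simp add: pqf_def)
  qed
  moreover have "0 < a / (n * n)"
    using a n by simp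
  ultimately show ?thesis
    unfolding eventually_nhds_metric by blast
qed

context simplex_family
begin

text \<open>The neighbour \<open>W\<close> and the affine weights of v are chosen once for
  \<open>Q\<close> and kept for \<open>Q'\<close>. What remains for each facet is one strict
  inequality, continuous in the form.\<close>

lemma eventually_regular:
  assumes Q: "Q \<in> pqf" and reg: "regular Q"
  shows "\<forall>\<^sub>F Q' in nhds Q. transpose Q' = Q' \<longrightarrow> regular Q'"
proof -
  have "\<forall>\<^sub>F Q' in nhds Q. transpose Q' = Q' \<longrightarrow> (\<exists>W\<in>cells. V - {v} \<subseteq> W \<and> outside_sphere Q' W v)"
    if Vv: "V \<in> F" "v \<in> V" for V v
  proof -
    obtain W where W: "W \<in> cells" "V - {v} \<subseteq> W" "outside_sphere Q W v"
      using reg Vv unfolding regular_def by blast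
    note W' = unimodular_cells[OF W(1)]
    note fin = unimodular_simplex_finite[OF W']
    obtain \<beta> where \<beta>: "sum \<beta> W = 1" "v = (\<Sum>u\<in>W. \<beta> u *\<^sub>R u)"
      using affine_hull_UNIV_weights[OF fin unimodular_simplex_affine_hull[OF W'], of v] by blast
    have less: "(\<Sum>u\<in>W. \<beta> u * qform Q u) < qform Q v"
      by (rule outside_sphere_sum_less[OF Q fin unimodular_simplex_nonempty[OF W'] unimodular_simplex_affine_independent[OF W'] \<beta> W(3)])
    have tends: "((\<lambda>Q'. qform Q' x) \<longlongrightarrow> qform Q x) (nhds Q)" for x
      using linear_continuous_at[OF linear_qform_matrix[unfolded linear_conv_bounded_linear], of Q x]
        tendsto_at_iff_tendsto_nhds[of "\<lambda>Q'. qform Q' x" Q] by (simp add: isCont_def)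
    have "((\<lambda>Q'. qform Q' v - (\<Sum>u\<in>W. \<beta> u * qform Q' u)) \<longlongrightarrow> qform Q v - (\<Sum>u\<in>W. \<beta> u * qform Q u)) (nhds Q)"
      by (intro tendsto_intros tends)
    then have "\<forall>\<^sub>F Q' in nhds Q. 0 < qform Q' v - (\<Sum>u\<in>W. \<beta> u * qform Q' u)"
      by (rule order_tendstoD) (use less in simp)
    then show ?thesis
    proof eventually_elim
      case (elim Q')
      then show ?case
        using outside_sphereI[OF _ fin \<beta>, of Q'] W(1,2) by auto
    qed
  qed
  then have "\<forall>\<^sub>F Q' in nhds Q. \<forall>V\<in>F. \<forall>v\<in>V. transpose Q' = Q' \<longrightarrow> (\<exists>W\<in>cells. V - {v} \<subseteq> W \<and> outside_sphere Q' W v)"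
    by (intro eventually_ball_finite finite_F ballI unimodular_simplex_finite unimodular_F)
  then show ?thesis
    by eventually_elim (auto simp: regular_def)
qed

lemma in_interior_of_secondary_cone:
  assumes Q: "Q \<in> pqf" and reg: "regular Q"
  shows "in_interior_of_secondary_cone Q"
proof -
  have "\<forall>\<^sub>F Q' in nhds Q. transpose Q' = Q' \<longrightarrow> Q' \<in> secondary_cone (Del Q)"
    using eventually_pqf[OF Q] eventually_regular[OF Q reg]
  proof eventually_elim
    case (elim Q')
    then show ?case
      using Del_eq[OF Q reg] Del_eq[of Q'] by (simp add: secondary_cone_def)
  qed
  then obtain S where S: "open S" "Q \<in> S" "\<And>Q'. Q' \<in> S \<Longrightarrow> transpose Q' = Q' \<Longrightarrow> Q' \<in> secondary_cone (Del Q)"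
    unfolding eventually_nhds by blast
  have "openin (top_of_set {A. transpose A = A}) ({A. transpose A = A} \<inter> S)"
    using S(1) by (rule openin_open_Int)
  then have "Q \<in> top_of_set {A. transpose A = A} interior_of secondary_cone (Del Q)"
    unfolding interior_of_def using S(2,3) pqf_sym[OF Q] by blast
  then show ?thesis
    unfolding in_interior_of_secondary_cone_def using triangulation_Del[OF Q reg] by blast
qed

end

section \<open>Lattice isometries\<close>

definition isometries :: "(real^'n^'n) set \<Rightarrow> (real^'n \<Rightarrow> real^'n) set" where
  "isometries \<Q> = {g. linear g \<and> (\<forall>x\<in>int_vecs. g x \<in> int_vecs) \<and> (\<forall>Q\<in>\<Q>. \<forall>x. qform Q (g x) = qform Q x)}"

lemma isometries_id: "id \<in> isometries \<Q>"
  by (simp add: isometries_def linear_id)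

lemma isometries_uminus: "g \<in> isometries \<Q> \<Longrightarrow> (\<lambda>x. - g x) \<in> isometries \<Q>"
  using int_vecs_diff[OF int_vecs_zero] by (auto simp: isometries_def linear_compose_neg)

lemma isometries_comp: "g \<in> isometries \<Q> \<Longrightarrow> h \<in> isometries \<Q> \<Longrightarrow> g \<circ> h \<in> isometries \<Q>"
  by (auto simp: isometries_def linear_compose)

lemma isometries_linear: "g \<in> isometries \<Q> \<Longrightarrow> linear g"
  by (simp add: isometries_def)

lemma isometries_qform: "g \<in> isometries \<Q> \<Longrightarrow> Q \<in> \<Q> \<Longrightarrow> qform Q (g x) = qform Q x"
  by (simp add: isometries_def)

text \<open>A linear map is determined by the images of the basis, and these are lattice vectors of
  prescribed length.\<close>

lemma finite_isometries:
  assumes "Q \<in> \<Q>" "Q \<in> pqf"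
  shows "finite (isometries \<Q>)"
proof (rule finite_imageD)
  show "inj_on (\<lambda>g. restrict g Basis) (isometries \<Q>)"
  proof (rule inj_onI)
    fix g h :: "real^'a \<Rightarrow> real^'a"
    assume gh: "g \<in> isometries \<Q>" "h \<in> isometries \<Q>" "restrict g Basis = restrict h Basis"
    show "g = h"
    proof (rule linear_eq_stdbasis[OF gh(1,2)[THEN isometries_linear]])
      show "g b = h b" if "b \<in> Basis" for b
        using gh(3) that by (metis restrict_apply')
    qed
  qed
  have "(\<lambda>g. restrict g Basis) ` isometries \<Q> \<subseteq> PiE Basis (\<lambda>b. {v \<in> int_vecs. qform Q (v - 0) \<le> qform Q b})"
  proof (intro image_subsetI)
    fix g :: "real^'a \<Rightarrow> real^'a"
    assume g: "g \<in> isometries \<Q>"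
    then have "g b \<in> int_vecs" if "b \<in> Basis" for b
      using that Basis_subset_int_vecs unfolding isometries_def by blast
    then show "restrict g Basis \<in> PiE Basis (\<lambda>b. {v \<in> int_vecs. qform Q (v - 0) \<le> qform Q b})"
      by (auto simp: isometries_qform[OF g assms(1)])
  qed
  then show "finite ((\<lambda>g. restrict g Basis) ` isometries \<Q>)"
    by (rule finite_subset) (intro finite_PiE finite_Basis finite_int_vecs_qform_le assms(2))
qed

lemma isometries_inj:
  assumes "Q \<in> \<Q>" "Q \<in> pqf" "g \<in> isometries \<Q>"
  shows "inj g"
proof (rule linear_injective_0[OF isometries_linear[OF assms(3)], THEN iffD2, rule_format])
  show "x = 0" if "g x = 0" for x
    using isometries_qform[OF assms(3,1), of x] pqf_pos[OF assms(2), of x] that by auto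
qed

text \<open>A finite cancellative monoid is a group.\<close>

lemma isometries_comp_image:
  assumes "Q \<in> \<Q>" "Q \<in> pqf" "g \<in> isometries \<Q>"
  shows "(\<circ>) g ` isometries \<Q> = isometries \<Q>"
proof (rule endo_inj_surj[OF finite_isometries[OF assms(1,2)]])
  show "(\<circ>) g ` isometries \<Q> \<subseteq> isometries \<Q>"
    using isometries_comp[OF assms(3)] by auto
  show "inj_on ((\<circ>) g) (isometries \<Q>)"
    using isometries_inj[OF assms] by (intro inj_onI) (simp add: fun.inj_map_strong fun_eq_iff inj_eq)
qed

lemma isometries_comp_image_right:
  assumes "Q \<in> \<Q>" "Q \<in> pqf" "g \<in> isometries \<Q>"
  shows "bij_betw (\<lambda>h. h \<circ> g) (isometries \<Q>) (isometries \<Q>)"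
proof -
  have "surj g"
    by (simp add: linear_injective_imp_surjective isometries_linear[OF assms(3)] isometries_inj[OF assms])
  have "inj_on (\<lambda>h. h \<circ> g) (isometries \<Q>)"
  proof (rule inj_onI, rule ext)
    fix h k :: "real^'a \<Rightarrow> real^'a" and y
    assume eq: "h \<circ> g = k \<circ> g"
    obtain x where "y = g x"
      using \<open>surj g\<close> by (rule surjE)
    then show "h y = k y"
      using fun_cong[OF eq, of x] by simp
  qed
  moreover have "(\<lambda>h. h \<circ> g) ` isometries \<Q> \<subseteq> isometries \<Q>"
    using isometries_comp assms(3) by blast
  ultimately show ?thesis
    unfolding bij_betw_def using endo_inj_surj[OF finite_isometries[OF assms(1,2)]] by blast
qed

lemma isometries_lattice_aut:
  assumes "Q \<in> \<Q>" "Q \<in> pqf" "g \<in> isometries \<Q>"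
  shows "lattice_aut g"
proof -
  obtain h where h: "h \<in> isometries \<Q>" "g \<circ> h = id"
    using isometries_comp_image[OF assms] isometries_id by (metis imageE)
  have "int_vecs \<subseteq> g ` int_vecs"
  proof
    fix x :: "real^'a"
    assume "x \<in> int_vecs"
    then have "h x \<in> int_vecs"
      using h(1) by (auto simp: isometries_def)
    moreover have "x = g (h x)"
      using h(2) by (metis comp_apply id_apply)
    ultimately show "x \<in> g ` int_vecs"
      by blast
  qed
  moreover have "g ` int_vecs \<subseteq> int_vecs"
    using assms(3) by (auto simp: isometries_def)
  moreover have "linear g" "inj g"
    using isometries_linear[OF assms(3)] isometries_inj[OF assms] by auto
  ultimately show ?thesis
    by (auto simp: lattice_aut_def bij_def linear_injective_imp_surjective)
qed

lemma qform_congruence: "qform (transpose M ** Q ** M) x = qform Q (M *v x)"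
proof -
  have "(transpose M ** Q ** M) *v x = transpose M *v (Q *v (M *v x))"
    by (simp add: matrix_vector_mul_assoc matrix_mul_assoc)
  then show ?thesis
    unfolding qform_def by (metis dot_lmul_matrix transpose_matrix_vector transpose_transpose)
qed

lemma transpose_sum: "transpose (\<Sum>i\<in>I. A i) = (\<Sum>i\<in>I. transpose (A i))"
  by (simp add: vec_eq_iff transpose_def)

text \<open>Reynolds operator without division by the group order, which cancels in the homogeneous
  estimate of \<open>packing_covering_bound\<close>. Right composition permutes the summands and
  gives the invariance.\<close>

lemma isometry_average:
  fixes Q' :: "real^'n^'n"
  assumes "Q \<in> \<Q>" "Q \<in> pqf" and sym: "transpose Q' = Q'"
  obtains A where "transpose A = A" "\<And>x. qform A x = (\<Sum>g\<in>isometries \<Q>. qform Q' (g x))"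
    "\<And>g x. g \<in> isometries \<Q> \<Longrightarrow> qform A (g x) = qform A x"
proof
  define A where "A = (\<Sum>g\<in>isometries \<Q>. transpose (matrix g) ** Q' ** matrix g)"
  show "transpose A = A"
    unfolding A_def by (simp add: transpose_sum matrix_transpose_mul sym matrix_mul_assoc)
  show *: "qform A x = (\<Sum>g\<in>isometries \<Q>. qform Q' (g x))" for x
    unfolding A_def qform_sum_matrix qform_congruence
    by (intro sum.cong refl) (simp add: matrix_works isometries_linear)
  show "qform A (g x) = qform A x" if "g \<in> isometries \<Q>" for g x
    unfolding * using sum.reindex_bij_betw[OF isometries_comp_image_right[OF assms(1,2) that], of "\<lambda>h. qform Q' (h x)"]
    by simp
qed

text \<open>Linear isometries only; translations enter through \<open>cells\<close>.\<close>

definition orbit_family :: "(real^'n^'n) set \<Rightarrow> (real^'n) set set \<Rightarrow> (real^'n) set set" where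
  "orbit_family \<Q> B = (\<Union>V\<in>B. (\<lambda>g. g ` V) ` isometries \<Q>)"

lemma simplex_family_orbits:
  assumes "Q \<in> \<Q>" "Q \<in> pqf" "finite B" "B \<noteq> {}" "\<And>V. V \<in> B \<Longrightarrow> unimodular_simplex V"
  shows "simplex_family (orbit_family \<Q> B)"
proof
  show "finite (orbit_family \<Q> B)"
    unfolding orbit_family_def using assms(3) finite_isometries[OF assms(1,2)] by blast
  show "orbit_family \<Q> B \<noteq> {}"
    unfolding orbit_family_def using assms(4) isometries_id by blast
  show "unimodular_simplex V" if V: "V \<in> orbit_family \<Q> B" for V
  proof -
    obtain U g where "U \<in> B" "g \<in> isometries \<Q>" "V = g ` U"
      using V by (auto simp: orbit_family_def)
    then show ?thesis
      using unimodular_simplex_aut_image[OF assms(5) isometries_lattice_aut[OF assms(1,2)], of U g 0] by simp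
  qed
qed

text \<open>Isometries carry neighbours to neighbours, so the facets of the representatives suffice.
  Pulling v back to p states the sphere condition for a representative, and one such condition can
  serve several facets.\<close>

lemma orbit_family_regular:
  assumes fam: "simplex_family (orbit_family \<Q> B)"
    and Q0: "Q0 \<in> \<Q>" "Q0 \<in> pqf" and inv: "\<And>g x. g \<in> isometries \<Q> \<Longrightarrow> qform Q (g x) = qform Q x"
    and nb: "\<And>V v. V \<in> B \<Longrightarrow> v \<in> V \<Longrightarrow> \<exists>U\<in>B. \<exists>g\<in>isometries \<Q>. \<exists>t\<in>int_vecs. \<exists>p.
      v = t + g p \<and> V - {v} \<subseteq> (\<lambda>x. t + g x) ` U \<and> outside_sphere Q U p"
  shows "simplex_family.regular (orbit_family \<Q> B) Q"
proof -
  interpret simplex_family "orbit_family \<Q> B"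
    by (rule fam)
  show ?thesis
    unfolding regular_def
  proof (intro ballI)
    fix V' v'
    assume "V' \<in> orbit_family \<Q> B" "v' \<in> V'"
    then obtain V h v where h: "V \<in> B" "h \<in> isometries \<Q>" "V' = h ` V" "v \<in> V" "v' = h v"
      by (auto simp: orbit_family_def)
    obtain U g t p where g: "U \<in> B" "g \<in> isometries \<Q>" "t \<in> int_vecs" "v = t + g p"
      "V - {v} \<subseteq> (\<lambda>x. t + g x) ` U" "outside_sphere Q U p"
      using nb[OF h(1,4)] by blast
    have hg: "h \<circ> g \<in> isometries \<Q>"
      using h(2) g(2) by (rule isometries_comp)
    have lin: "h (t + g x) = h t + (h \<circ> g) x" for x
      using linear_add[OF isometries_linear[OF h(2)]] by simp
    define W where "W = (\<lambda>x. h t + (h \<circ> g) x) ` U"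
    have "h t \<in> int_vecs"
      using h(2) g(3) by (auto simp: isometries_def)
    moreover have "W = (+) (h t) ` (h \<circ> g) ` U"
      by (simp add: W_def image_image)
    moreover have "(h \<circ> g) ` U \<in> orbit_family \<Q> B"
      unfolding orbit_family_def using g(1) hg by blast
    ultimately have "W \<in> cells"
      by (simp add: cells_translate F_subset_cells)
    moreover have "V' - {v'} \<subseteq> W"
    proof
      fix w'
      assume "w' \<in> V' - {v'}"
      then obtain w where "w \<in> V - {v}" "w' = h w"
        using h(3,5) by blast
      then obtain x where "x \<in> U" "w' = h (t + g x)"
        using g(5) by blast
      then show "w' \<in> W"
        unfolding W_def lin by blast
    qed
    moreover have "outside_sphere Q W v'"
      unfolding W_def h(5) g(4) lin
      using isometries_lattice_aut[OF Q0 hg] unfolding lattice_aut_def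
      by (intro outside_sphere_image[OF isometries_linear[OF hg] _ inv[OF hg] g(6)]) blast
    ultimately show "\<exists>W\<in>cells. V' - {v'} \<subseteq> W \<and> outside_sphere Q W v'"
      by blast
  qed
qed

text \<open>Averaging the linear lower bound of \<open>covering_mu_ge_cell\<close> over the isometry group leaves a
  condition on invariant forms only.\<close>

lemma packing_covering_bound:
  assumes fam: "simplex_family (orbit_family \<Q> B)" and Q0: "Q0 \<in> \<Q>" "Q0 \<in> pqf"
    and V: "V \<in> B" "finite V" and \<alpha>: "sum \<alpha> V = 1" "c = (\<Sum>v\<in>V. \<alpha> v *\<^sub>R v)"
    and e: "e \<in> int_vecs" "e \<noteq> 0" and "0 \<le> \<kappa>"
    and key: "\<And>A. transpose A = A \<Longrightarrow> (\<And>g x. g \<in> isometries \<Q> \<Longrightarrow> qform A (g x) = qform A x) \<Longrightarrow>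
      (\<Sum>v\<in>V. \<alpha> v * qform A (v - c)) = \<kappa> * qform A e"
    and Q: "Q \<in> pqf" "simplex_family.regular (orbit_family \<Q> B) Q"
  shows "\<kappa> * packing_lambda Q \<le> covering_mu Q"
proof -
  interpret simplex_family "orbit_family \<Q> B"
    by (rule fam)
  let ?G = "isometries \<Q>"
  have fin: "finite ?G"
    by (rule finite_isometries[OF Q0])
  obtain A where A: "transpose A = A" "\<And>x. qform A x = (\<Sum>g\<in>?G. qform Q (g x))"
    "\<And>g x. g \<in> ?G \<Longrightarrow> qform A (g x) = qform A x"
    using isometry_average[OF Q0 pqf_sym[OF Q(1)]] by blast
  have lower: "(\<Sum>v\<in>V. \<alpha> v * qform Q (g (v - c))) \<le> covering_mu Q" if g: "g \<in> ?G" for g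
  proof -
    have cell: "g ` V \<in> cells"
      using V(1) g by (intro F_subset_cells) (auto simp: orbit_family_def)
    have inj: "inj g"
      by (rule isometries_inj[OF Q0 g])
    have lin: "linear g"
      by (rule isometries_linear[OF g])
    \<comment> \<open>Weights travel with the vertices. The summand type is left open because both
      real and vector sums are reindexed.\<close>
    have reindex: "(\<Sum>w\<in>g ` V. f (inv g w) w) = (\<Sum>v\<in>V. f v (g v))" for f :: "real^'a \<Rightarrow> real^'a \<Rightarrow> 'b::comm_monoid_add"
      by (simp add: sum.reindex[OF inj_on_subset[OF inj subset_UNIV]] inv_f_f[OF inj])
    have "(\<Sum>w\<in>g ` V. (\<alpha> \<circ> inv g) w * qform Q (w - g c)) \<le> covering_mu Q"
    proof (rule covering_mu_ge_cell[OF Q cell])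
      show "sum (\<alpha> \<circ> inv g) (g ` V) = 1"
        using reindex[of "\<lambda>v w. \<alpha> v"] \<alpha>(1) by simp
      show "g c = (\<Sum>w\<in>g ` V. (\<alpha> \<circ> inv g) w *\<^sub>R w)"
        using reindex[of "\<lambda>v w. \<alpha> v *\<^sub>R w"] unfolding \<alpha>(2) by (simp add: linear_sum[OF lin] linear_scale[OF lin])
    qed
    then show ?thesis
      using reindex[of "\<lambda>v w. \<alpha> v * qform Q (w - g c)"] by (simp add: linear_diff[OF lin])
  qed
  have card: "0 < real (card ?G)"
    using fin isometries_id[of \<Q>] card_gt_0_iff by auto
  have "real (card ?G) * (\<kappa> * packing_lambda Q) = (\<Sum>g\<in>?G. \<kappa> * packing_lambda Q)"
    by simp
  \<comment> \<open>Each \<open>g e\<close> is a nonzero lattice vector, so it bounds the packing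
    minimum from above whether or not it is shortest for \<open>Q\<close>.\<close>
  also have "\<dots> \<le> (\<Sum>g\<in>?G. \<kappa> * qform Q (g e))"
  proof (intro sum_mono mult_left_mono \<open>0 \<le> \<kappa>\<close> packing_lambda_le Q)
    fix g
    assume g: "g \<in> ?G"
    show "g e \<in> int_vecs"
      using g e(1) by (auto simp: isometries_def)
    show "g e \<noteq> 0"
      using isometries_inj[OF Q0 g] e(2) linear_0[OF isometries_linear[OF g]] by (metis injD)
  qed
  also have "\<dots> = \<kappa> * qform A e"
    unfolding A(2) sum_distrib_left ..
  also have "\<dots> = (\<Sum>v\<in>V. \<alpha> v * qform A (v - c))"
    by (rule key[symmetric, OF A(1)]) (rule A(3))
  also have "\<dots> = (\<Sum>g\<in>?G. \<Sum>v\<in>V. \<alpha> v * qform Q (g (v - c)))"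
    unfolding A(2) sum_distrib_left by (rule sum.swap)
  also have "\<dots> \<le> (\<Sum>g\<in>?G. covering_mu Q)"
    by (intro sum_mono lower)
  also have "\<dots> = real (card ?G) * covering_mu Q"
    by simp
  finally show ?thesis
    using card by simp
qed

lemma locally_optimal_packing_coveringI:
  fixes Q :: "real^'n^'n"
  assumes fam: "simplex_family F" and Q: "Q \<in> pqf" "simplex_family.regular F Q"
    and bound: "\<And>Q'. Q' \<in> pqf \<Longrightarrow> simplex_family.regular F Q' \<Longrightarrow> \<kappa> * packing_lambda Q' \<le> covering_mu Q'"
    and eq: "covering_mu Q \<le> \<kappa> * packing_lambda Q"
  shows "locally_optimal_packing_covering Q"
proof -
  interpret simplex_family F
    by (rule fam)
  have "\<forall>\<^sub>F Q' in at Q within pqf. Q' \<in> pqf \<and> regular Q'"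
    using eventually_at_filter[of "\<lambda>Q'. Q' \<in> pqf \<and> regular Q'"] eventually_regular[OF Q]
    by (auto elim!: eventually_mono simp: pqf_sym)
  then have "\<forall>\<^sub>F Q' in at Q within pqf. packing_covering_gamma Q \<le> packing_covering_gamma Q'"
  proof eventually_elim
    case (elim Q')
    have "covering_mu Q / packing_lambda Q \<le> \<kappa>"
      using eq packing_lambda_pos[OF Q(1)] by (simp add: field_simps)
    also have "\<kappa> \<le> covering_mu Q' / packing_lambda Q'"
      using bound[of Q'] packing_lambda_pos[of Q'] elim by (simp add: field_simps)
    finally show ?case
      by (simp add: packing_covering_gamma_def)
  qed
  then show ?thesis
    using Q(1) by (simp add: locally_optimal_packing_covering_def)
qed

section \<open>Computing in dimension six\<close>

lemma exhaust_6:
  fixes x :: 6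
  shows "x = 1 \<or> x = 2 \<or> x = 3 \<or> x = 4 \<or> x = 5 \<or> x = 6"
proof (induct x)
  case (of_int z)
  \<comment> \<open>Elements of the type 6 are residues modulo 6, and the index 6 is the residue
    0.\<close>
  then have "z = 0 \<or> z = 1 \<or> z = 2 \<or> z = 3 \<or> z = 4 \<or> z = 5"
    by simp arith
  then show ?case
    by auto
qed

lemma UNIV_6: "(UNIV :: 6 set) = {1, 2, 3, 4, 5, 6}"
  using exhaust_6 by auto

lemma forall_6: "(\<forall>i::6. P i) \<longleftrightarrow> P 1 \<and> P 2 \<and> P 3 \<and> P 4 \<and> P 5 \<and> P 6"
  by (metis exhaust_6)

lemma sum_6: "sum f (UNIV :: 6 set) = f 1 + f 2 + f 3 + f 4 + f 5 + f 6"
  unfolding UNIV_6 by (simp add: ac_simps)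

lemma vector_6 [simp]:
  "(vector [a, b, c, d, e, f] :: 'a::zero^6) $ 1 = a"
  "(vector [a, b, c, d, e, f] :: 'a::zero^6) $ 2 = b"
  "(vector [a, b, c, d, e, f] :: 'a::zero^6) $ 3 = c"
  "(vector [a, b, c, d, e, f] :: 'a::zero^6) $ 4 = d"
  "(vector [a, b, c, d, e, f] :: 'a::zero^6) $ 5 = e"
  "(vector [a, b, c, d, e, f] :: 'a::zero^6) $ 6 = f"
  unfolding vector_def by simp_all

lemma vector_6_eq_iff:
  "(vector [a, b, c, d, e, f] :: 'a::zero^6) = vector [a', b', c', d', e', f'] \<longleftrightarrow>
     a = a' \<and> b = b' \<and> c = c' \<and> d = d' \<and> e = e' \<and> f = f'"
  "(vector [a, b, c, d, e, f] :: 'a::zero^6) = 0 \<longleftrightarrow>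
     a = 0 \<and> b = 0 \<and> c = 0 \<and> d = 0 \<and> e = 0 \<and> f = 0"
  "0 = (vector [a, b, c, d, e, f] :: 'a::zero^6) \<longleftrightarrow>
     a = 0 \<and> b = 0 \<and> c = 0 \<and> d = 0 \<and> e = 0 \<and> f = 0"
  by (auto simp: vec_eq_iff forall_6)

lemma vector_6_arith:
  fixes a :: real
  shows
  "(vector [a, b, c, d, e, f] :: real^6) + vector [a', b', c', d', e', f'] =
     vector [a + a', b + b', c + c', d + d', e + e', f + f']"
  "(vector [a, b, c, d, e, f] :: real^6) - vector [a', b', c', d', e', f'] =
     vector [a - a', b - b', c - c', d - d', e - e', f - f']"
  "- (vector [a, b, c, d, e, f] :: real^6) = vector [- a, - b, - c, - d, - e, - f]"
  "(vector [0, 0, 0, 0, 0, 0] :: real^6) = 0"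
  "k *\<^sub>R (vector [a, b, c, d, e, f] :: real^6) = vector [k * a, k * b, k * c, k * d, k * e, k * f]"
  by (simp_all add: vec_eq_iff forall_6)

lemma matrix_vector_6:
  fixes r :: "real^6"
  shows "(vector [r1, r2, r3, r4, r5, r6] :: real^6^6) *v r = vector [r1 \<bullet> r, r2 \<bullet> r, r3 \<bullet> r, r4 \<bullet> r, r5 \<bullet> r, r6 \<bullet> r]"
  by (simp add: vec_eq_iff forall_6 matrix_vector_mul_component)

lemma inner_vector_6:
  "(vector [a, b, c, d, e, f] :: real^6) \<bullet> vector [a', b', c', d', e', f'] =
     a * a' + b * b' + c * c' + d * d' + e * e' + f * f'"
  by (simp add: inner_vec_def sum_6)

lemma vector_6_expand: "(x :: real^6) = vector [x $ 1, x $ 2, x $ 3, x $ 4, x $ 5, x $ 6]"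
  by (simp add: vec_eq_iff forall_6)

lemma int_vecs_6: "(vector [a, b, c, d, e, f] :: real^6) \<in> int_vecs \<longleftrightarrow>
    a \<in> \<int> \<and> b \<in> \<int> \<and> c \<in> \<int> \<and> d \<in> \<int> \<and> e \<in> \<int> \<and> f \<in> \<int>"
  by (simp add: int_vecs_def forall_6)

lemma axis_6:
  "axis 1 1 = (vector [1, 0, 0, 0, 0, 0] :: real^6)"
  "axis 2 1 = (vector [0, 1, 0, 0, 0, 0] :: real^6)"
  "axis 3 1 = (vector [0, 0, 1, 0, 0, 0] :: real^6)"
  "axis 4 1 = (vector [0, 0, 0, 1, 0, 0] :: real^6)"
  "axis 5 1 = (vector [0, 0, 0, 0, 1, 0] :: real^6)"
  "axis 6 1 = (vector [0, 0, 0, 0, 0, 1] :: real^6)"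
  by (simp_all add: vec_eq_iff forall_6 axis_def)

lemma Basis_6: "(Basis :: (real^6) set) =
   {vector [1, 0, 0, 0, 0, 0], vector [0, 1, 0, 0, 0, 0], vector [0, 0, 1, 0, 0, 0],
    vector [0, 0, 0, 1, 0, 0], vector [0, 0, 0, 0, 1, 0], vector [0, 0, 0, 0, 0, 1]}"
  unfolding Basis_eq_range_axis UNIV_6
  by (simp add: axis_6)

lemma integral_matrix_int_vecs:
  fixes M :: "real^'n^'n"
  assumes "\<forall>i j. M $ i $ j \<in> \<int>" "x \<in> int_vecs"
  shows "M *v x \<in> int_vecs"
  using assms by (auto simp: int_vecs_def matrix_vector_mult_def intro!: Ints_sum Ints_mult)

lemma lattice_aut_matrix:
  fixes M N :: "real^'n^'n"
  assumes "\<forall>i j. M $ i $ j \<in> \<int>" "\<forall>i j. N $ i $ j \<in> \<int>" "M ** N = mat 1"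
  shows "lattice_aut ((*v) M)"
proof -
  have "N ** M = mat 1"
    using assms(3) by (simp add: matrix_left_right_inverse)
  then have inv: "M *v (N *v x) = x" "N *v (M *v x) = x" for x
    using assms(3) by (simp_all add: matrix_vector_mul_assoc)
  have "bij ((*v) M)"
    by (rule o_bij[where g = "(*v) N"]) (simp_all add: fun_eq_iff inv)
  moreover have "x \<in> (*v) M ` int_vecs" if "x \<in> int_vecs" for x
    using integral_matrix_int_vecs[OF assms(2) that] by (intro image_eqI[of _ _ "N *v x"]) (simp_all add: inv)
  ultimately show ?thesis
    using integral_matrix_int_vecs[OF assms(1)] by (auto simp: lattice_aut_def)
qed

lemma isometries_matrix:
  fixes M :: "real^'n^'n"
  assumes "\<forall>i j. M $ i $ j \<in> \<int>" "\<And>Q. Q \<in> \<Q> \<Longrightarrow> transpose M ** Q ** M = Q"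
  shows "(*v) M \<in> isometries \<Q>"
  using integral_matrix_int_vecs[OF assms(1)] assms(2)
  by (auto simp: isometries_def simp flip: qform_congruence)

text \<open>When 0 is a vertex, r = Q[c], so Q[u] = 2 u . Q c for every vertex u, which is linear in
  u. Linear coefficients then replace affine ones: the weight of 0 and zero weights drop out, and a
  list can be evaluated by simplification.\<close>

lemma outside_sphere_listI:
  assumes sym: "transpose Q = Q" and "0 \<in> U" "snd ` set ps \<subseteq> U"
    and p: "p = (\<Sum>(y, u)\<leftarrow>ps. y *\<^sub>R u)" and less: "(\<Sum>(y, u)\<leftarrow>ps. y * qform Q u) < qform Q p"
  shows "outside_sphere Q U p"
  unfolding outside_sphere_def
proof (intro allI impI)
  fix c r
  assume c: "circumsphere Q U c r"
  then have r: "r = qform Q c"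
    using \<open>0 \<in> U\<close> by (auto simp: circumsphere_def)
  have "qform Q u = 2 * (u \<bullet> (Q *v c))" if "u \<in> U" for u
    using c that qform_diff_scaled[OF sym, of u c] by (simp add: circumsphere_def r)
  then have "2 * ((\<Sum>(y, u)\<leftarrow>ps. y *\<^sub>R u) \<bullet> (Q *v c)) = (\<Sum>(y, u)\<leftarrow>ps. y * qform Q u)"
    using assms(3) by (induction ps) (auto simp: inner_add_left algebra_simps)
  then show "r < qform Q (p - c)"
    using less qform_diff_scaled[OF sym, of p c] by (simp add: r p)
qed

section \<open>The simplices and the isometry group of \<open>Q_pc_6\<close>\<close>

lemma Q_E6_dual_sym: "transpose Q_E6_dual = Q_E6_dual"
  by (simp add: vec_eq_iff forall_6 transpose_def Q_E6_dual_def)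

lemma R1_sym: "transpose R1 = R1"
  by (simp add: vec_eq_iff forall_6 transpose_def R1_def)

text \<open>Lagrange reduction. The same six linear forms diagonalise \<open>R1\<close> in
  \<open>R1_squares\<close>, with other positive coefficients.\<close>

lemma Q_E6_dual_squares: "qform Q_E6_dual x =
      4 * (x $ 1 + 1/4 * x $ 2 + 1/2 * x $ 3 + 1/2 * x $ 4 - 1/4 * x $ 5 + 1/4 * x $ 6)\<^sup>2
      + 15/4 * (x $ 2 + 2/5 * x $ 3 + 2/5 * x $ 4 + 3/5 * x $ 5 + 1/5 * x $ 6)\<^sup>2
      + 12/5 * (x $ 3 - 1/4 * x $ 4 + 1/4 * x $ 5 + 1/2 * x $ 6)\<^sup>2
      + 9/4 * (x $ 4 + 1/3 * x $ 5 + 2/3 * x $ 6)\<^sup>2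
      + 2 * (x $ 5 + 1/2 * x $ 6)\<^sup>2
      + 3/2 * (x $ 6)\<^sup>2"
  by (subst vector_6_expand, subst (2) vector_6_expand)
     (simp add: qform_def Q_E6_dual_def matrix_vector_6 inner_vector_6 power2_eq_square algebra_simps)

lemma R1_squares: "qform R1 x =
      12 * (x $ 1 + 1/4 * x $ 2 + 1/2 * x $ 3 + 1/2 * x $ 4 - 1/4 * x $ 5 + 1/4 * x $ 6)\<^sup>2
      + 25/4 * (x $ 2 + 2/5 * x $ 3 + 2/5 * x $ 4 + 3/5 * x $ 5 + 1/5 * x $ 6)\<^sup>2
      + 4 * (x $ 3 - 1/4 * x $ 4 + 1/4 * x $ 5 + 1/2 * x $ 6)\<^sup>2
      + 15/4 * (x $ 4 + 1/3 * x $ 5 + 2/3 * x $ 6)\<^sup>2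
      + 10/3 * (x $ 5 + 1/2 * x $ 6)\<^sup>2
      + 5/2 * (x $ 6)\<^sup>2"
  by (subst vector_6_expand, subst (2) vector_6_expand)
     (simp add: qform_def R1_def matrix_vector_6 inner_vector_6 power2_eq_square algebra_simps)

lemma sum_six_squares_le_0:
  fixes a b c d e f :: real
  assumes "0 < a" "0 < b" "0 < c" "0 < d" "0 < e" "0 < f"
    and "a * u\<^sup>2 + b * v\<^sup>2 + c * w\<^sup>2 + d * x\<^sup>2 + e * y\<^sup>2 + f * z\<^sup>2 \<le> 0"
  shows "u = 0 \<and> v = 0 \<and> w = 0 \<and> x = 0 \<and> y = 0 \<and> z = 0"
proof -
  have "0 \<le> a * u\<^sup>2" "0 \<le> b * v\<^sup>2" "0 \<le> c * w\<^sup>2" "0 \<le> d * x\<^sup>2" "0 \<le> e * y\<^sup>2" "0 \<le> f * z\<^sup>2"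
    using assms(1-6) by simp_all
  then have "a * u\<^sup>2 = 0" "b * v\<^sup>2 = 0" "c * w\<^sup>2 = 0" "d * x\<^sup>2 = 0" "e * y\<^sup>2 = 0" "f * z\<^sup>2 = 0"
    using assms(7) by linarith+
  then show ?thesis
    using assms(1-6) by simp
qed

lemma Q_E6_dual_pqf: "Q_E6_dual \<in> pqf"
proof -
  have "0 < qform Q_E6_dual x" if "x \<noteq> 0" for x
  proof (rule ccontr)
    assume "\<not> 0 < qform Q_E6_dual x"
    from sum_six_squares_le_0[OF _ _ _ _ _ _ this[unfolded Q_E6_dual_squares not_less]]
    have "x = 0"
      by (simp add: vec_eq_iff forall_6)
    then show False
      using that by simp
  qed
  then show ?thesis
    by (simp add: pqf_def Q_E6_dual_sym)
qed

lemma R1_nonneg: "0 \<le> qform R1 x"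
  unfolding R1_squares by (intro add_nonneg_nonneg mult_nonneg_nonneg) auto

text \<open>The isometries of both \<open>Q_E6_dual\<close> and \<open>R1\<close> form a group of order 3840. The twelve below were
  selected by computer so that, together with their negatives and \<open>id\<close>, they map suitable
  translates of the three representatives below onto all their facet neighbours.\<close>

definition iso1 :: "real^6^6" where
  "iso1 = vector
     [vector [1, 0, 0, 1, -1, 0],
      vector [0, -1, 0, 0, 0, 0],
      vector [0, 0, 0, -1, 0, 0],
      vector [0, 1, 1, 0, 1, 1],
      vector [0, 0, 0, 0, -1, 0],
      vector [0, 0, 0, 0, 0, -1]]"

definition iso2 :: "real^6^6" where
  "iso2 = vector
     [vector [1, 0, 1, 0, -1, 0],
      vector [0, -1, 0, 0, 0, 0],
      vector [0, 1, 0, 1, 1, 1],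
      vector [0, 0, -1, 0, 0, 0],
      vector [0, 0, 0, 0, -1, 0],
      vector [0, 0, 0, 0, 0, -1]]"

definition iso3 :: "real^6^6" where
  "iso3 = vector
     [vector [1, 1, 1, 1, 1, 1],
      vector [0, -1, 0, 0, 0, 1],
      vector [0, 0, 0, -1, -1, -1],
      vector [0, 0, -1, 0, -1, -1],
      vector [0, 1, 0, 0, 1, 0],
      vector [0, -1, 0, 0, 0, 0]]"

definition iso4 :: "real^6^6" where
  "iso4 = vector
     [vector [1, 0, 0, 0, -1, 0],
      vector [0, 1, 0, 0, 1, 0],
      vector [0, 0, 1, 0, 0, 0],
      vector [0, 0, 0, 1, 0, 0],
      vector [0, 0, 0, 0, -1, 0],
      vector [0, 0, 0, 0, 1, 1]]"

definition iso5 :: "real^6^6" where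
  "iso5 = vector
     [vector [1, 1, 1, 0, 0, 0],
      vector [0, 0, -1, 0, 0, 0],
      vector [0, -1, 0, 0, 0, 0],
      vector [0, 0, 0, 1, 0, 0],
      vector [0, 1, 1, 0, 1, 0],
      vector [0, 0, 0, 0, 0, 1]]"

definition iso6 :: "real^6^6" where
  "iso6 = vector
     [vector [1, 0, 1, 0, 0, 0],
      vector [0, 1, 1, 0, 0, 0],
      vector [0, 0, -1, 0, 0, 0],
      vector [0, 0, -1, 1, 0, 0],
      vector [0, 0, 0, 0, 1, 0],
      vector [0, 0, 1, 0, 0, 1]]"

definition iso7 :: "real^6^6" where
  "iso7 = vector
     [vector [1, 0, 1, 0, 0, 1],
      vector [0, 1, 0, 0, 0, 0],
      vector [0, 0, 0, 0, 0, -1],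
      vector [0, 0, 0, 1, 0, 0],
      vector [0, 0, 1, 0, 1, 1],
      vector [0, 0, -1, 0, 0, 0]]"

definition iso8 :: "real^6^6" where
  "iso8 = vector
     [vector [1, 1, 0, 1, 0, 0],
      vector [0, 0, 0, 0, 1, 0],
      vector [0, -1, 0, -1, -1, 0],
      vector [0, 0, 1, 0, 0, 1],
      vector [0, 1, 0, 0, 0, 0],
      vector [0, 0, 0, 0, 0, -1]]"

definition iso9 :: "real^6^6" where
  "iso9 = vector
     [vector [1, 1, 0, 1, 0, 0],
      vector [0, 0, 0, 0, 0, -1],
      vector [0, -1, 0, -1, -1, 0],
      vector [0, 0, 1, 0, 0, 1],
      vector [0, 1, 0, 0, 0, 0],
      vector [0, 0, 0, 0, 1, 0]]"

definition iso10 :: "real^6^6" where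
  "iso10 = vector
     [vector [1, 1, 1, 1, 0, 0],
      vector [0, 0, 1, 0, 0, 1],
      vector [0, -1, -1, 0, 0, 0],
      vector [0, 0, -1, 0, 0, 0],
      vector [0, 1, 0, 1, 1, 0],
      vector [0, 0, 1, -1, 0, 0]]"

definition iso11 :: "real^6^6" where
  "iso11 = vector
     [vector [1, 1, 1, 1, 0, 1],
      vector [0, 0, -1, 0, 0, 0],
      vector [0, -1, 0, 0, 0, 0],
      vector [0, 0, 0, 0, 0, -1],
      vector [0, 1, 1, 1, 1, 1],
      vector [0, 0, 0, -1, 0, 0]]"

definition iso12 :: "real^6^6" where
  "iso12 = vector
     [vector [1, 0, 1, 1, 0, 1],
      vector [0, 0, 1, -1, 0, 0],
      vector [0, 0, -1, 0, 0, -1],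
      vector [0, 0, -1, 0, 0, 0],
      vector [0, 0, 0, 1, 1, 1],
      vector [0, 1, 1, 0, 0, 0]]"

abbreviation isos :: "(real^6 \<Rightarrow> real^6) set" where
  "isos \<equiv> isometries {Q_E6_dual, R1}"

lemma iso1: "(*v) iso1 \<in> isos"
proof (rule isometries_matrix)
  show "\<forall>i j. iso1 $ i $ j \<in> \<int>"
    by (simp add: forall_6 iso1_def)
  have "transpose iso1 ** Q_E6_dual ** iso1 = Q_E6_dual"
    by (simp add: vec_eq_iff forall_6 matrix_matrix_mult_def sum_6 transpose_def iso1_def Q_E6_dual_def)
  moreover have "transpose iso1 ** R1 ** iso1 = R1"
    by (simp add: vec_eq_iff forall_6 matrix_matrix_mult_def sum_6 transpose_def iso1_def R1_def)
  ultimately show "transpose iso1 ** Q ** iso1 = Q" if "Q \<in> {Q_E6_dual, R1}" for Q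
    using that by auto
qed

lemma iso2: "(*v) iso2 \<in> isos"
proof (rule isometries_matrix)
  show "\<forall>i j. iso2 $ i $ j \<in> \<int>"
    by (simp add: forall_6 iso2_def)
  have "transpose iso2 ** Q_E6_dual ** iso2 = Q_E6_dual"
    by (simp add: vec_eq_iff forall_6 matrix_matrix_mult_def sum_6 transpose_def iso2_def Q_E6_dual_def)
  moreover have "transpose iso2 ** R1 ** iso2 = R1"
    by (simp add: vec_eq_iff forall_6 matrix_matrix_mult_def sum_6 transpose_def iso2_def R1_def)
  ultimately show "transpose iso2 ** Q ** iso2 = Q" if "Q \<in> {Q_E6_dual, R1}" for Q
    using that by auto
qed

lemma iso3: "(*v) iso3 \<in> isos"
proof (rule isometries_matrix)
  show "\<forall>i j. iso3 $ i $ j \<in> \<int>"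
    by (simp add: forall_6 iso3_def)
  have "transpose iso3 ** Q_E6_dual ** iso3 = Q_E6_dual"
    by (simp add: vec_eq_iff forall_6 matrix_matrix_mult_def sum_6 transpose_def iso3_def Q_E6_dual_def)
  moreover have "transpose iso3 ** R1 ** iso3 = R1"
    by (simp add: vec_eq_iff forall_6 matrix_matrix_mult_def sum_6 transpose_def iso3_def R1_def)
  ultimately show "transpose iso3 ** Q ** iso3 = Q" if "Q \<in> {Q_E6_dual, R1}" for Q
    using that by auto
qed

lemma iso4: "(*v) iso4 \<in> isos"
proof (rule isometries_matrix)
  show "\<forall>i j. iso4 $ i $ j \<in> \<int>"
    by (simp add: forall_6 iso4_def)
  have "transpose iso4 ** Q_E6_dual ** iso4 = Q_E6_dual"
    by (simp add: vec_eq_iff forall_6 matrix_matrix_mult_def sum_6 transpose_def iso4_def Q_E6_dual_def)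
  moreover have "transpose iso4 ** R1 ** iso4 = R1"
    by (simp add: vec_eq_iff forall_6 matrix_matrix_mult_def sum_6 transpose_def iso4_def R1_def)
  ultimately show "transpose iso4 ** Q ** iso4 = Q" if "Q \<in> {Q_E6_dual, R1}" for Q
    using that by auto
qed

lemma iso5: "(*v) iso5 \<in> isos"
proof (rule isometries_matrix)
  show "\<forall>i j. iso5 $ i $ j \<in> \<int>"
    by (simp add: forall_6 iso5_def)
  have "transpose iso5 ** Q_E6_dual ** iso5 = Q_E6_dual"
    by (simp add: vec_eq_iff forall_6 matrix_matrix_mult_def sum_6 transpose_def iso5_def Q_E6_dual_def)
  moreover have "transpose iso5 ** R1 ** iso5 = R1"
    by (simp add: vec_eq_iff forall_6 matrix_matrix_mult_def sum_6 transpose_def iso5_def R1_def)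
  ultimately show "transpose iso5 ** Q ** iso5 = Q" if "Q \<in> {Q_E6_dual, R1}" for Q
    using that by auto
qed

lemma iso6: "(*v) iso6 \<in> isos"
proof (rule isometries_matrix)
  show "\<forall>i j. iso6 $ i $ j \<in> \<int>"
    by (simp add: forall_6 iso6_def)
  have "transpose iso6 ** Q_E6_dual ** iso6 = Q_E6_dual"
    by (simp add: vec_eq_iff forall_6 matrix_matrix_mult_def sum_6 transpose_def iso6_def Q_E6_dual_def)
  moreover have "transpose iso6 ** R1 ** iso6 = R1"
    by (simp add: vec_eq_iff forall_6 matrix_matrix_mult_def sum_6 transpose_def iso6_def R1_def)
  ultimately show "transpose iso6 ** Q ** iso6 = Q" if "Q \<in> {Q_E6_dual, R1}" for Q
    using that by auto
qed

lemma iso7: "(*v) iso7 \<in> isos"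
proof (rule isometries_matrix)
  show "\<forall>i j. iso7 $ i $ j \<in> \<int>"
    by (simp add: forall_6 iso7_def)
  have "transpose iso7 ** Q_E6_dual ** iso7 = Q_E6_dual"
    by (simp add: vec_eq_iff forall_6 matrix_matrix_mult_def sum_6 transpose_def iso7_def Q_E6_dual_def)
  moreover have "transpose iso7 ** R1 ** iso7 = R1"
    by (simp add: vec_eq_iff forall_6 matrix_matrix_mult_def sum_6 transpose_def iso7_def R1_def)
  ultimately show "transpose iso7 ** Q ** iso7 = Q" if "Q \<in> {Q_E6_dual, R1}" for Q
    using that by auto
qed

lemma iso8: "(*v) iso8 \<in> isos"
proof (rule isometries_matrix)
  show "\<forall>i j. iso8 $ i $ j \<in> \<int>"
    by (simp add: forall_6 iso8_def)
  have "transpose iso8 ** Q_E6_dual ** iso8 = Q_E6_dual"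
    by (simp add: vec_eq_iff forall_6 matrix_matrix_mult_def sum_6 transpose_def iso8_def Q_E6_dual_def)
  moreover have "transpose iso8 ** R1 ** iso8 = R1"
    by (simp add: vec_eq_iff forall_6 matrix_matrix_mult_def sum_6 transpose_def iso8_def R1_def)
  ultimately show "transpose iso8 ** Q ** iso8 = Q" if "Q \<in> {Q_E6_dual, R1}" for Q
    using that by auto
qed

lemma iso9: "(*v) iso9 \<in> isos"
proof (rule isometries_matrix)
  show "\<forall>i j. iso9 $ i $ j \<in> \<int>"
    by (simp add: forall_6 iso9_def)
  have "transpose iso9 ** Q_E6_dual ** iso9 = Q_E6_dual"
    by (simp add: vec_eq_iff forall_6 matrix_matrix_mult_def sum_6 transpose_def iso9_def Q_E6_dual_def)
  moreover have "transpose iso9 ** R1 ** iso9 = R1"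
    by (simp add: vec_eq_iff forall_6 matrix_matrix_mult_def sum_6 transpose_def iso9_def R1_def)
  ultimately show "transpose iso9 ** Q ** iso9 = Q" if "Q \<in> {Q_E6_dual, R1}" for Q
    using that by auto
qed

lemma iso10: "(*v) iso10 \<in> isos"
proof (rule isometries_matrix)
  show "\<forall>i j. iso10 $ i $ j \<in> \<int>"
    by (simp add: forall_6 iso10_def)
  have "transpose iso10 ** Q_E6_dual ** iso10 = Q_E6_dual"
    by (simp add: vec_eq_iff forall_6 matrix_matrix_mult_def sum_6 transpose_def iso10_def Q_E6_dual_def)
  moreover have "transpose iso10 ** R1 ** iso10 = R1"
    by (simp add: vec_eq_iff forall_6 matrix_matrix_mult_def sum_6 transpose_def iso10_def R1_def)
  ultimately show "transpose iso10 ** Q ** iso10 = Q" if "Q \<in> {Q_E6_dual, R1}" for Q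
    using that by auto
qed

lemma iso11: "(*v) iso11 \<in> isos"
proof (rule isometries_matrix)
  show "\<forall>i j. iso11 $ i $ j \<in> \<int>"
    by (simp add: forall_6 iso11_def)
  have "transpose iso11 ** Q_E6_dual ** iso11 = Q_E6_dual"
    by (simp add: vec_eq_iff forall_6 matrix_matrix_mult_def sum_6 transpose_def iso11_def Q_E6_dual_def)
  moreover have "transpose iso11 ** R1 ** iso11 = R1"
    by (simp add: vec_eq_iff forall_6 matrix_matrix_mult_def sum_6 transpose_def iso11_def R1_def)
  ultimately show "transpose iso11 ** Q ** iso11 = Q" if "Q \<in> {Q_E6_dual, R1}" for Q
    using that by auto
qed

lemma iso12: "(*v) iso12 \<in> isos"
proof (rule isometries_matrix)
  show "\<forall>i j. iso12 $ i $ j \<in> \<int>"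
    by (simp add: forall_6 iso12_def)
  have "transpose iso12 ** Q_E6_dual ** iso12 = Q_E6_dual"
    by (simp add: vec_eq_iff forall_6 matrix_matrix_mult_def sum_6 transpose_def iso12_def Q_E6_dual_def)
  moreover have "transpose iso12 ** R1 ** iso12 = R1"
    by (simp add: vec_eq_iff forall_6 matrix_matrix_mult_def sum_6 transpose_def iso12_def R1_def)
  ultimately show "transpose iso12 ** Q ** iso12 = Q" if "Q \<in> {Q_E6_dual, R1}" for Q
    using that by auto
qed

text \<open>Representatives of the three orbits of Delone simplices, which contain 320, 80 and 320 simplices
  up to translation. The last orbit attains the covering radius.\<close>

definition cell0 :: "(real^6) set" where
  "cell0 =
    {0, vector [1, 0, 0, 0, 1, 0],
     vector [0, 1, 0, 0, 0, 0],
     vector [0, 0, 1, 0, 0, 0],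
     vector [0, 0, 0, 1, 0, 0],
     vector [0, -1, 1, 1, 1, -1],
     vector [0, 0, 0, 0, 0, 1]}"

lemma unimodular_cell0: "unimodular_simplex cell0"
proof -
  \<comment> \<open>The columns of \<open>M\<close> are the nonzero vertices of the cell in the
    listed order, and \<open>N\<close> is the inverse; its integrality is the unimodularity. The
    other two cells are treated alike.\<close>
  define M :: "real^6^6" where "M = vector
     [vector [1, 0, 0, 0, 0, 0],
      vector [0, 1, 0, 0, -1, 0],
      vector [0, 0, 1, 0, 1, 0],
      vector [0, 0, 0, 1, 1, 0],
      vector [1, 0, 0, 0, 1, 0],
      vector [0, 0, 0, 0, -1, 1]]"
  define N :: "real^6^6" where "N = vector
     [vector [1, 0, 0, 0, 0, 0],
      vector [-1, 1, 0, 0, 1, 0],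
      vector [1, 0, 1, 0, -1, 0],
      vector [1, 0, 0, 1, -1, 0],
      vector [-1, 0, 0, 0, 1, 0],
      vector [-1, 0, 0, 0, 1, 1]]"
  have "lattice_aut ((*v) M)"
    by (rule lattice_aut_matrix[of M N])
      (simp_all add: M_def N_def forall_6 vec_eq_iff matrix_matrix_mult_def sum_6 mat_def)
  moreover have "cell0 = (\<lambda>x. 0 + M *v x) ` insert 0 Basis"
    by (simp add: cell0_def M_def Basis_6 matrix_vector_6 inner_vector_6 vector_6_arith)
  ultimately show ?thesis
    unfolding unimodular_simplex_def using int_vecs_zero by blast
qed

definition cell1 :: "(real^6) set" where
  "cell1 =
    {0, vector [0, 1, 0, 0, 0, 0],
     vector [0, 0, 1, 0, 0, 0],
     vector [0, 0, 0, 1, 0, 0],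
     vector [0, -1, 1, 1, 1, -1],
     vector [0, 0, 0, 0, 0, 1],
     vector [-1, 0, 1, 1, 0, 0]}"

lemma unimodular_cell1: "unimodular_simplex cell1"
proof -
  define M :: "real^6^6" where "M = vector
     [vector [0, 0, 0, 0, 0, -1],
      vector [1, 0, 0, -1, 0, 0],
      vector [0, 1, 0, 1, 0, 1],
      vector [0, 0, 1, 1, 0, 1],
      vector [0, 0, 0, 1, 0, 0],
      vector [0, 0, 0, -1, 1, 0]]"
  define N :: "real^6^6" where "N = vector
     [vector [0, 1, 0, 0, 1, 0],
      vector [1, 0, 1, 0, -1, 0],
      vector [1, 0, 0, 1, -1, 0],
      vector [0, 0, 0, 0, 1, 0],
      vector [0, 0, 0, 0, 1, 1],
      vector [-1, 0, 0, 0, 0, 0]]"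
  have "lattice_aut ((*v) M)"
    by (rule lattice_aut_matrix[of M N])
      (simp_all add: M_def N_def forall_6 vec_eq_iff matrix_matrix_mult_def sum_6 mat_def)
  moreover have "cell1 = (\<lambda>x. 0 + M *v x) ` insert 0 Basis"
    by (simp add: cell1_def M_def Basis_6 matrix_vector_6 inner_vector_6 vector_6_arith)
  ultimately show ?thesis
    unfolding unimodular_simplex_def using int_vecs_zero by blast
qed

definition cell2 :: "(real^6) set" where
  "cell2 =
    {0, vector [1, 0, 0, 0, 1, 0],
     vector [0, 1, 0, 0, 0, 0],
     vector [0, 0, 0, 1, 0, 0],
     vector [0, -1, 1, 1, 1, -1],
     vector [0, 0, 0, 0, 0, 1],
     vector [0, 0, 0, 0, 1, 0]}"

lemma unimodular_cell2: "unimodular_simplex cell2"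
proof -
  define M :: "real^6^6" where "M = vector
     [vector [1, 0, 0, 0, 0, 0],
      vector [0, 1, 0, -1, 0, 0],
      vector [0, 0, 0, 1, 0, 0],
      vector [0, 0, 1, 1, 0, 0],
      vector [1, 0, 0, 1, 0, 1],
      vector [0, 0, 0, -1, 1, 0]]"
  define N :: "real^6^6" where "N = vector
     [vector [1, 0, 0, 0, 0, 0],
      vector [0, 1, 1, 0, 0, 0],
      vector [0, 0, -1, 1, 0, 0],
      vector [0, 0, 1, 0, 0, 0],
      vector [0, 0, 1, 0, 0, 1],
      vector [-1, 0, -1, 0, 1, 0]]"
  have "lattice_aut ((*v) M)"
    by (rule lattice_aut_matrix[of M N])
      (simp_all add: M_def N_def forall_6 vec_eq_iff matrix_matrix_mult_def sum_6 mat_def)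
  moreover have "cell2 = (\<lambda>x. 0 + M *v x) ` insert 0 Basis"
    by (simp add: cell2_def M_def Basis_6 matrix_vector_6 inner_vector_6 vector_6_arith)
  ultimately show ?thesis
    unfolding unimodular_simplex_def using int_vecs_zero by blast
qed

text \<open>The positive root of 79 t^2 + 36 t - 6 = 0. At this value the squared circumradius of
  \<open>cell2\<close> divided by 4 + 7 t is stationary along the forms E + t R.\<close>

definition pc_t :: real where "pc_t = (sqrt 798 - 18) / 79"

lemma sqrt_798_bounds: "28.24889 < sqrt 798" "sqrt 798 < 28.2489"
  by (rule real_less_rsqrt, simp add: power2_eq_square, rule real_less_lsqrt, simp_all add: power2_eq_square)

lemma pc_t_pos: "0 < pc_t"
  using sqrt_798_bounds by (simp add: pc_t_def)

lemma qform_Q_pc_6: "qform Q_pc_6 x = qform Q_E6_dual x + pc_t * qform R1 x"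
  by (simp add: Q_pc_6_def pc_t_def qform_add_matrix qform_scaleR_matrix)

lemma Q_pc_6_sym: "transpose Q_pc_6 = Q_pc_6"
  by (simp add: vec_eq_iff forall_6 transpose_def Q_pc_6_def Q_E6_dual_def R1_def)

lemma Q_pc_6_pqf: "Q_pc_6 \<in> pqf"
  using pqf_pos[OF Q_E6_dual_pqf] R1_nonneg pc_t_pos
  by (auto simp: pqf_def Q_pc_6_sym qform_Q_pc_6 add_pos_nonneg)

lemma Q_pc_6_isos: "g \<in> isos \<Longrightarrow> qform Q_pc_6 (g x) = qform Q_pc_6 x"
  by (simp add: qform_Q_pc_6 isometries_def)

text \<open>Evaluation rules for explicit vectors: the matrix is multiplied out on the right and
  folded back to its name on the left, where the rule has to match.\<close>

lemmas qform_E6_dual_vector = qform_def[of Q_E6_dual "vector [a, b, c, d, e, f]" for a b c d e f,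
    unfolded Q_E6_dual_def matrix_vector_6 inner_vector_6, folded Q_E6_dual_def]
lemmas qform_R1_vector = qform_def[of R1 "vector [a, b, c, d, e, f]" for a b c d e f,
    unfolded R1_def matrix_vector_6 inner_vector_6, folded R1_def]

section \<open>The local condition at the 21 facets of the representatives\<close>

abbreviation reps :: "(real^6) set set" where
  "reps \<equiv> {cell0, cell1, cell2}"

lemma neighbourI:
  assumes "U \<in> reps" "g \<in> isos" "t \<in> int_vecs" "v = t + g p" "V - {v} \<subseteq> (\<lambda>x. t + g x) ` U"
    and "outside_sphere Q_pc_6 U p"
  shows "\<exists>U\<in>reps. \<exists>g\<in>isos. \<exists>t\<in>int_vecs. \<exists>p.
    v = t + g p \<and> V - {v} \<subseteq> (\<lambda>x. t + g x) ` U \<and> outside_sphere Q_pc_6 U p"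
  using assms by blast

text \<open>In these ten lemmas \<open>ps\<close> is the expansion of the outer point in the nonzero
  vertices of the cell. The resulting inequality is linear in \<open>pc_t\<close> and follows from
  \<open>pc_t\<close> > 0 alone. Here its two sides differ by 2 \<open>pc_t\<close>: at t = 0 the
  point would lie on the sphere, so the term with \<open>R1\<close> is what separates
  \<open>cell0\<close> from \<open>cell1\<close>.\<close>

lemma outside_cell0_1: "outside_sphere Q_pc_6 cell0 (vector [-1, 0, 1, 1, 0, 0])"
proof (rule outside_sphere_listI[where ps =
      "[(-1, vector [1, 0, 0, 0, 1, 0]), (1, vector [0, 1, 0, 0, 0, 0]),
        (1, vector [0, -1, 1, 1, 1, -1]), (1, vector [0, 0, 0, 0, 0, 1])]"])
qed (use pc_t_pos in \<open>simp_all add: Q_pc_6_sym cell0_def vector_6_eq_iff vector_6_arith qform_Q_pc_6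
      qform_E6_dual_vector qform_R1_vector algebra_simps\<close>)

lemma outside_cell1_1: "outside_sphere Q_pc_6 cell1 (vector [1, 0, 0, 0, 1, 0])"
proof (rule outside_sphere_listI[where ps =
      "[(1, vector [0, 1, 0, 0, 0, 0]), (1, vector [0, -1, 1, 1, 1, -1]),
        (1, vector [0, 0, 0, 0, 0, 1]), (-1, vector [-1, 0, 1, 1, 0, 0])]"])
qed (use pc_t_pos in \<open>simp_all add: Q_pc_6_sym cell1_def vector_6_eq_iff vector_6_arith qform_Q_pc_6
      qform_E6_dual_vector qform_R1_vector algebra_simps\<close>)

lemma outside_cell0_2: "outside_sphere Q_pc_6 cell0 (vector [1, 0, 0, 0, 1, -1])"
proof (rule outside_sphere_listI[where ps =
      "[(1, vector [1, 0, 0, 0, 1, 0]), (-1, vector [0, 0, 0, 0, 0, 1])]"])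
qed (use pc_t_pos in \<open>simp_all add: Q_pc_6_sym cell0_def vector_6_eq_iff vector_6_arith qform_Q_pc_6
      qform_E6_dual_vector qform_R1_vector algebra_simps\<close>)

lemma outside_cell2_1: "outside_sphere Q_pc_6 cell2 (vector [0, 0, 1, 0, 0, 0])"
proof (rule outside_sphere_listI[where ps =
      "[(1, vector [0, 1, 0, 0, 0, 0]), (-1, vector [0, 0, 0, 1, 0, 0]),
        (1, vector [0, -1, 1, 1, 1, -1]), (1, vector [0, 0, 0, 0, 0, 1]),
        (-1, vector [0, 0, 0, 0, 1, 0])]"])
qed (use pc_t_pos in \<open>simp_all add: Q_pc_6_sym cell2_def vector_6_eq_iff vector_6_arith qform_Q_pc_6
      qform_E6_dual_vector qform_R1_vector algebra_simps\<close>)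

lemma outside_cell2_2: "outside_sphere Q_pc_6 cell2 (vector [-1, 0, 1, 1, 0, 0])"
proof (rule outside_sphere_listI[where ps =
      "[(-1, vector [1, 0, 0, 0, 1, 0]), (1, vector [0, 1, 0, 0, 0, 0]),
        (1, vector [0, -1, 1, 1, 1, -1]), (1, vector [0, 0, 0, 0, 0, 1])]"])
qed (use pc_t_pos in \<open>simp_all add: Q_pc_6_sym cell2_def vector_6_eq_iff vector_6_arith qform_Q_pc_6
      qform_E6_dual_vector qform_R1_vector algebra_simps\<close>)

lemma outside_cell0_3: "outside_sphere Q_pc_6 cell0 (vector [1, 1, -1, -1, 0, 1])"
proof (rule outside_sphere_listI[where ps =
      "[(1, vector [1, 0, 0, 0, 1, 0]), (-1, vector [0, -1, 1, 1, 1, -1])]"])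
qed (use pc_t_pos in \<open>simp_all add: Q_pc_6_sym cell0_def vector_6_eq_iff vector_6_arith qform_Q_pc_6
      qform_E6_dual_vector qform_R1_vector algebra_simps\<close>)

lemma outside_cell0_4: "outside_sphere Q_pc_6 cell0 (vector [1, -1, 0, 0, 1, 0])"
proof (rule outside_sphere_listI[where ps =
      "[(1, vector [1, 0, 0, 0, 1, 0]), (-1, vector [0, 1, 0, 0, 0, 0])]"])
qed (use pc_t_pos in \<open>simp_all add: Q_pc_6_sym cell0_def vector_6_eq_iff vector_6_arith qform_Q_pc_6
      qform_E6_dual_vector qform_R1_vector algebra_simps\<close>)

lemma outside_cell1_2: "outside_sphere Q_pc_6 cell1 (vector [-1, 0, 1, 1, -1, 0])"
proof (rule outside_sphere_listI[where ps =
      "[(-1, vector [0, 1, 0, 0, 0, 0]), (1, vector [0, 0, 1, 0, 0, 0]),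
        (1, vector [0, 0, 0, 1, 0, 0]), (-1, vector [0, -1, 1, 1, 1, -1]),
        (-1, vector [0, 0, 0, 0, 0, 1]), (1, vector [-1, 0, 1, 1, 0, 0])]"])
qed (use pc_t_pos in \<open>simp_all add: Q_pc_6_sym cell1_def vector_6_eq_iff vector_6_arith qform_Q_pc_6
      qform_E6_dual_vector qform_R1_vector algebra_simps\<close>)

lemma outside_cell0_5: "outside_sphere Q_pc_6 cell0 (vector [0, 0, 0, 0, 1, 0])"
proof (rule outside_sphere_listI[where ps =
      "[(1, vector [0, 1, 0, 0, 0, 0]), (-1, vector [0, 0, 1, 0, 0, 0]),
        (-1, vector [0, 0, 0, 1, 0, 0]), (1, vector [0, -1, 1, 1, 1, -1]),
        (1, vector [0, 0, 0, 0, 0, 1])]"])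
qed (use pc_t_pos in \<open>simp_all add: Q_pc_6_sym cell0_def vector_6_eq_iff vector_6_arith qform_Q_pc_6
      qform_E6_dual_vector qform_R1_vector algebra_simps\<close>)

lemma outside_cell2_3: "outside_sphere Q_pc_6 cell2 (vector [1, 0, -1, 0, 1, 0])"
proof (rule outside_sphere_listI[where ps =
      "[(1, vector [1, 0, 0, 0, 1, 0]), (-1, vector [0, 1, 0, 0, 0, 0]),
        (1, vector [0, 0, 0, 1, 0, 0]), (-1, vector [0, -1, 1, 1, 1, -1]),
        (-1, vector [0, 0, 0, 0, 0, 1]), (1, vector [0, 0, 0, 0, 1, 0])]"])
qed (use pc_t_pos in \<open>simp_all add: Q_pc_6_sym cell2_def vector_6_eq_iff vector_6_arith qform_Q_pc_6
      qform_E6_dual_vector qform_R1_vector algebra_simps\<close>)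

lemmas neighbour_simps = insert_Diff_if int_vecs_6 vector_6_eq_iff vector_6_arith matrix_vector_6 inner_vector_6

text \<open>In this and the next twenty lemmas the affine map given by g and t sends a
  representative onto the neighbour across the facet opposite the named vertex; t is the image of
  its vertex 0.\<close>

lemma neighbour_cell0_0:
  "\<exists>U\<in>reps. \<exists>g\<in>isos. \<exists>t\<in>int_vecs. \<exists>p. 0 = t + g p \<and>
    cell0 - {0} \<subseteq> (\<lambda>x. t + g x) ` U \<and> outside_sphere Q_pc_6 U p"
  by (rule neighbourI[OF _ iso3 _ _ _ outside_cell0_1, where t = "vector [-1, 0, 1, 1, 0, 0]"])
    (simp_all add: cell0_def iso3_def neighbour_simps)

lemma neighbour_cell0_1:
  "\<exists>U\<in>reps. \<exists>g\<in>isos. \<exists>t\<in>int_vecs. \<exists>p. vector [1, 0, 0, 0, 1, 0] = t + g p \<and>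
    cell0 - {vector [1, 0, 0, 0, 1, 0]} \<subseteq> (\<lambda>x. t + g x) ` U \<and> outside_sphere Q_pc_6 U p"
  by (rule neighbourI[OF _ isometries_id _ _ _ outside_cell1_1, where t = "0"])
    (simp_all add: cell0_def cell1_def neighbour_simps)

lemma neighbour_cell0_2:
  "\<exists>U\<in>reps. \<exists>g\<in>isos. \<exists>t\<in>int_vecs. \<exists>p. vector [0, 1, 0, 0, 0, 0] = t + g p \<and>
    cell0 - {vector [0, 1, 0, 0, 0, 0]} \<subseteq> (\<lambda>x. t + g x) ` U \<and> outside_sphere Q_pc_6 U p"
  by (rule neighbourI[OF _ isometries_uminus[OF iso10] _ _ _ outside_cell0_2, where t = "vector [1, 0, 0, 0, 1, 0]"])
    (simp_all add: cell0_def iso10_def neighbour_simps)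

lemma neighbour_cell0_3:
  "\<exists>U\<in>reps. \<exists>g\<in>isos. \<exists>t\<in>int_vecs. \<exists>p. vector [0, 0, 1, 0, 0, 0] = t + g p \<and>
    cell0 - {vector [0, 0, 1, 0, 0, 0]} \<subseteq> (\<lambda>x. t + g x) ` U \<and> outside_sphere Q_pc_6 U p"
  by (rule neighbourI[OF _ isometries_id _ _ _ outside_cell2_1, where t = "0"])
    (simp_all add: cell0_def cell2_def neighbour_simps)

lemma neighbour_cell0_4:
  "\<exists>U\<in>reps. \<exists>g\<in>isos. \<exists>t\<in>int_vecs. \<exists>p. vector [0, 0, 0, 1, 0, 0] = t + g p \<and>
    cell0 - {vector [0, 0, 0, 1, 0, 0]} \<subseteq> (\<lambda>x. t + g x) ` U \<and> outside_sphere Q_pc_6 U p"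
  by (rule neighbourI[OF _ isometries_uminus[OF iso2] _ _ _ outside_cell2_2, where t = "vector [0, 0, 1, 0, 0, 0]"])
    (simp_all add: cell0_def cell2_def iso2_def neighbour_simps)

lemma neighbour_cell0_5:
  "\<exists>U\<in>reps. \<exists>g\<in>isos. \<exists>t\<in>int_vecs. \<exists>p. vector [0, -1, 1, 1, 1, -1] = t + g p \<and>
    cell0 - {vector [0, -1, 1, 1, 1, -1]} \<subseteq> (\<lambda>x. t + g x) ` U \<and> outside_sphere Q_pc_6 U p"
  by (rule neighbourI[OF _ isometries_uminus[OF iso11] _ _ _ outside_cell0_3, where t = "vector [1, 0, 0, 0, 1, 0]"])
    (simp_all add: cell0_def iso11_def neighbour_simps)

lemma neighbour_cell0_6:
  "\<exists>U\<in>reps. \<exists>g\<in>isos. \<exists>t\<in>int_vecs. \<exists>p. vector [0, 0, 0, 0, 0, 1] = t + g p \<and>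
    cell0 - {vector [0, 0, 0, 0, 0, 1]} \<subseteq> (\<lambda>x. t + g x) ` U \<and> outside_sphere Q_pc_6 U p"
  by (rule neighbourI[OF _ isometries_uminus[OF iso12] _ _ _ outside_cell0_4, where t = "vector [1, 0, 0, 0, 1, 0]"])
    (simp_all add: cell0_def iso12_def neighbour_simps)

lemma neighbour_cell1_0:
  "\<exists>U\<in>reps. \<exists>g\<in>isos. \<exists>t\<in>int_vecs. \<exists>p. 0 = t + g p \<and>
    cell1 - {0} \<subseteq> (\<lambda>x. t + g x) ` U \<and> outside_sphere Q_pc_6 U p"
  by (rule neighbourI[OF _ iso3 _ _ _ outside_cell0_1, where t = "vector [-1, 0, 1, 1, 0, 0]"])
    (simp_all add: cell1_def cell0_def iso3_def neighbour_simps)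

lemma neighbour_cell1_1:
  "\<exists>U\<in>reps. \<exists>g\<in>isos. \<exists>t\<in>int_vecs. \<exists>p. vector [0, 1, 0, 0, 0, 0] = t + g p \<and>
    cell1 - {vector [0, 1, 0, 0, 0, 0]} \<subseteq> (\<lambda>x. t + g x) ` U \<and> outside_sphere Q_pc_6 U p"
  by (rule neighbourI[OF _ isometries_uminus[OF iso8] _ _ _ outside_cell1_2, where t = "vector [0, 0, 0, 1, 0, 0]"])
    (simp_all add: cell1_def iso8_def neighbour_simps)

lemma neighbour_cell1_2:
  "\<exists>U\<in>reps. \<exists>g\<in>isos. \<exists>t\<in>int_vecs. \<exists>p. vector [0, 0, 1, 0, 0, 0] = t + g p \<and>
    cell1 - {vector [0, 0, 1, 0, 0, 0]} \<subseteq> (\<lambda>x. t + g x) ` U \<and> outside_sphere Q_pc_6 U p"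
  by (rule neighbourI[OF _ isometries_uminus[OF iso1] _ _ _ outside_cell0_1, where t = "vector [0, 0, 0, 1, 0, 0]"])
    (simp_all add: cell1_def cell0_def iso1_def neighbour_simps)

lemma neighbour_cell1_3:
  "\<exists>U\<in>reps. \<exists>g\<in>isos. \<exists>t\<in>int_vecs. \<exists>p. vector [0, 0, 0, 1, 0, 0] = t + g p \<and>
    cell1 - {vector [0, 0, 0, 1, 0, 0]} \<subseteq> (\<lambda>x. t + g x) ` U \<and> outside_sphere Q_pc_6 U p"
  by (rule neighbourI[OF _ isometries_uminus[OF iso2] _ _ _ outside_cell0_1, where t = "vector [0, 0, 1, 0, 0, 0]"])
    (simp_all add: cell1_def cell0_def iso2_def neighbour_simps)

lemma neighbour_cell1_4:
  "\<exists>U\<in>reps. \<exists>g\<in>isos. \<exists>t\<in>int_vecs. \<exists>p. vector [0, -1, 1, 1, 1, -1] = t + g p \<and>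
    cell1 - {vector [0, -1, 1, 1, 1, -1]} \<subseteq> (\<lambda>x. t + g x) ` U \<and> outside_sphere Q_pc_6 U p"
  by (rule neighbourI[OF _ iso4 _ _ _ outside_cell1_2, where t = "0"])
    (simp_all add: cell1_def iso4_def neighbour_simps)

lemma neighbour_cell1_5:
  "\<exists>U\<in>reps. \<exists>g\<in>isos. \<exists>t\<in>int_vecs. \<exists>p. vector [0, 0, 0, 0, 0, 1] = t + g p \<and>
    cell1 - {vector [0, 0, 0, 0, 0, 1]} \<subseteq> (\<lambda>x. t + g x) ` U \<and> outside_sphere Q_pc_6 U p"
  by (rule neighbourI[OF _ isometries_uminus[OF iso9] _ _ _ outside_cell1_2, where t = "vector [0, 0, 0, 1, 0, 0]"])
    (simp_all add: cell1_def iso9_def neighbour_simps)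

lemma neighbour_cell1_6:
  "\<exists>U\<in>reps. \<exists>g\<in>isos. \<exists>t\<in>int_vecs. \<exists>p. vector [-1, 0, 1, 1, 0, 0] = t + g p \<and>
    cell1 - {vector [-1, 0, 1, 1, 0, 0]} \<subseteq> (\<lambda>x. t + g x) ` U \<and> outside_sphere Q_pc_6 U p"
  by (rule neighbourI[OF _ isometries_id _ _ _ outside_cell0_1, where t = "0"])
    (simp_all add: cell1_def cell0_def neighbour_simps)

lemma neighbour_cell2_0:
  "\<exists>U\<in>reps. \<exists>g\<in>isos. \<exists>t\<in>int_vecs. \<exists>p. 0 = t + g p \<and>
    cell2 - {0} \<subseteq> (\<lambda>x. t + g x) ` U \<and> outside_sphere Q_pc_6 U p"
  by (rule neighbourI[OF _ iso3 _ _ _ outside_cell2_2, where t = "vector [-1, 0, 1, 1, 0, 0]"])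
    (simp_all add: cell2_def iso3_def neighbour_simps)

lemma neighbour_cell2_1:
  "\<exists>U\<in>reps. \<exists>g\<in>isos. \<exists>t\<in>int_vecs. \<exists>p. vector [1, 0, 0, 0, 1, 0] = t + g p \<and>
    cell2 - {vector [1, 0, 0, 0, 1, 0]} \<subseteq> (\<lambda>x. t + g x) ` U \<and> outside_sphere Q_pc_6 U p"
  by (rule neighbourI[OF _ isometries_uminus[OF iso1] _ _ _ outside_cell0_5, where t = "vector [0, 0, 0, 1, 0, 0]"])
    (simp_all add: cell2_def cell0_def iso1_def neighbour_simps)

lemma neighbour_cell2_2:
  "\<exists>U\<in>reps. \<exists>g\<in>isos. \<exists>t\<in>int_vecs. \<exists>p. vector [0, 1, 0, 0, 0, 0] = t + g p \<and>
    cell2 - {vector [0, 1, 0, 0, 0, 0]} \<subseteq> (\<lambda>x. t + g x) ` U \<and> outside_sphere Q_pc_6 U p"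
  by (rule neighbourI[OF _ iso5 _ _ _ outside_cell2_3, where t = "0"])
    (simp_all add: cell2_def iso5_def neighbour_simps)

lemma neighbour_cell2_3:
  "\<exists>U\<in>reps. \<exists>g\<in>isos. \<exists>t\<in>int_vecs. \<exists>p. vector [0, 0, 0, 1, 0, 0] = t + g p \<and>
    cell2 - {vector [0, 0, 0, 1, 0, 0]} \<subseteq> (\<lambda>x. t + g x) ` U \<and> outside_sphere Q_pc_6 U p"
  by (rule neighbourI[OF _ isometries_uminus[OF iso2] _ _ _ outside_cell2_2, where t = "vector [0, 0, 1, 0, 0, 0]"])
    (simp_all add: cell2_def iso2_def neighbour_simps)

lemma neighbour_cell2_4:
  "\<exists>U\<in>reps. \<exists>g\<in>isos. \<exists>t\<in>int_vecs. \<exists>p. vector [0, -1, 1, 1, 1, -1] = t + g p \<and>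
    cell2 - {vector [0, -1, 1, 1, 1, -1]} \<subseteq> (\<lambda>x. t + g x) ` U \<and> outside_sphere Q_pc_6 U p"
  by (rule neighbourI[OF _ iso6 _ _ _ outside_cell2_3, where t = "0"])
    (simp_all add: cell2_def iso6_def neighbour_simps)

lemma neighbour_cell2_5:
  "\<exists>U\<in>reps. \<exists>g\<in>isos. \<exists>t\<in>int_vecs. \<exists>p. vector [0, 0, 0, 0, 0, 1] = t + g p \<and>
    cell2 - {vector [0, 0, 0, 0, 0, 1]} \<subseteq> (\<lambda>x. t + g x) ` U \<and> outside_sphere Q_pc_6 U p"
  by (rule neighbourI[OF _ iso7 _ _ _ outside_cell2_3, where t = "0"])
    (simp_all add: cell2_def iso7_def neighbour_simps)

lemma neighbour_cell2_6:
  "\<exists>U\<in>reps. \<exists>g\<in>isos. \<exists>t\<in>int_vecs. \<exists>p. vector [0, 0, 0, 0, 1, 0] = t + g p \<and>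
    cell2 - {vector [0, 0, 0, 0, 1, 0]} \<subseteq> (\<lambda>x. t + g x) ` U \<and> outside_sphere Q_pc_6 U p"
  by (rule neighbourI[OF _ isometries_id _ _ _ outside_cell0_5, where t = "0"])
    (simp_all add: cell2_def cell0_def neighbour_simps)

lemma neighbours_cell0:
  assumes "v \<in> cell0"
  shows "\<exists>U\<in>reps. \<exists>g\<in>isos. \<exists>t\<in>int_vecs. \<exists>p.
    v = t + g p \<and> cell0 - {v} \<subseteq> (\<lambda>x. t + g x) ` U \<and> outside_sphere Q_pc_6 U p"
proof -
  have "v \<in> {0, vector [1, 0, 0, 0, 1, 0], vector [0, 1, 0, 0, 0, 0],
    vector [0, 0, 1, 0, 0, 0], vector [0, 0, 0, 1, 0, 0], vector [0, -1, 1, 1, 1, -1],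
    vector [0, 0, 0, 0, 0, 1]}"
    using assms by (simp only: cell0_def)
  then show ?thesis
    using neighbour_cell0_0 neighbour_cell0_1 neighbour_cell0_2 neighbour_cell0_3 neighbour_cell0_4
      neighbour_cell0_5 neighbour_cell0_6
    by (elim insertE emptyE) (simp_all only:)
qed

lemma neighbours_cell1:
  assumes "v \<in> cell1"
  shows "\<exists>U\<in>reps. \<exists>g\<in>isos. \<exists>t\<in>int_vecs. \<exists>p.
    v = t + g p \<and> cell1 - {v} \<subseteq> (\<lambda>x. t + g x) ` U \<and> outside_sphere Q_pc_6 U p"
proof -
  have "v \<in> {0, vector [0, 1, 0, 0, 0, 0], vector [0, 0, 1, 0, 0, 0],
    vector [0, 0, 0, 1, 0, 0], vector [0, -1, 1, 1, 1, -1], vector [0, 0, 0, 0, 0, 1],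
    vector [-1, 0, 1, 1, 0, 0]}"
    using assms by (simp only: cell1_def)
  then show ?thesis
    using neighbour_cell1_0 neighbour_cell1_1 neighbour_cell1_2 neighbour_cell1_3 neighbour_cell1_4
      neighbour_cell1_5 neighbour_cell1_6
    by (elim insertE emptyE) (simp_all only:)
qed

lemma neighbours_cell2:
  assumes "v \<in> cell2"
  shows "\<exists>U\<in>reps. \<exists>g\<in>isos. \<exists>t\<in>int_vecs. \<exists>p.
    v = t + g p \<and> cell2 - {v} \<subseteq> (\<lambda>x. t + g x) ` U \<and> outside_sphere Q_pc_6 U p"
proof -
  have "v \<in> {0, vector [1, 0, 0, 0, 1, 0], vector [0, 1, 0, 0, 0, 0],
    vector [0, 0, 0, 1, 0, 0], vector [0, -1, 1, 1, 1, -1], vector [0, 0, 0, 0, 0, 1],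
    vector [0, 0, 0, 0, 1, 0]}"
    using assms by (simp only: cell2_def)
  then show ?thesis
    using neighbour_cell2_0 neighbour_cell2_1 neighbour_cell2_2 neighbour_cell2_3 neighbour_cell2_4
      neighbour_cell2_5 neighbour_cell2_6
    by (elim insertE emptyE) (simp_all only:)
qed

interpretation pc: simplex_family "orbit_family {Q_E6_dual, R1} reps"
  using Q_E6_dual_pqf unimodular_cell0 unimodular_cell1 unimodular_cell2
  by (intro simplex_family_orbits[of Q_E6_dual]) auto

lemma Q_pc_6_regular: "pc.regular Q_pc_6"
proof (rule orbit_family_regular[OF pc.simplex_family_axioms _ Q_E6_dual_pqf])
  show "qform Q_pc_6 (g x) = qform Q_pc_6 x" if "g \<in> isos" for g x
    using that by (rule Q_pc_6_isos)
  show "\<exists>U\<in>reps. \<exists>g\<in>isos. \<exists>t\<in>int_vecs. \<exists>p.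
      v = t + g p \<and> V - {v} \<subseteq> (\<lambda>x. t + g x) ` U \<and> outside_sphere Q_pc_6 U p"
    if "V \<in> reps" "v \<in> V" for V v
    using that neighbours_cell0 neighbours_cell1 neighbours_cell2 by (elim insertE emptyE) (simp_all only:)
qed simp_all

lemmas vector_value_simps = vector_6_eq_iff vector_6_arith qform_Q_pc_6 qform_E6_dual_vector qform_R1_vector

text \<open>Only entries on or above the diagonal occur, so that each instance of invariance becomes
  a linear equation in the same 21 unknowns.\<close>

lemma qform_6_symmetric:
  fixes A :: "real^6^6"
  assumes "transpose A = A"
  shows "qform A x =
      x $ 1 * (A $ 1 $ 1 * x $ 1 + 2 * (A $ 1 $ 2 * x $ 2 + A $ 1 $ 3 * x $ 3 + A $ 1 $ 4 * x $ 4 + A $ 1 $ 5 * x $ 5 + A $ 1 $ 6 * x $ 6))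
    + x $ 2 * (A $ 2 $ 2 * x $ 2 + 2 * (A $ 2 $ 3 * x $ 3 + A $ 2 $ 4 * x $ 4 + A $ 2 $ 5 * x $ 5 + A $ 2 $ 6 * x $ 6))
    + x $ 3 * (A $ 3 $ 3 * x $ 3 + 2 * (A $ 3 $ 4 * x $ 4 + A $ 3 $ 5 * x $ 5 + A $ 3 $ 6 * x $ 6))
    + x $ 4 * (A $ 4 $ 4 * x $ 4 + 2 * (A $ 4 $ 5 * x $ 5 + A $ 4 $ 6 * x $ 6))
    + x $ 5 * (A $ 5 $ 5 * x $ 5 + 2 * (A $ 5 $ 6 * x $ 6))
    + x $ 6 * (A $ 6 $ 6 * x $ 6)"
proof -
  have sym: "A $ j $ i = A $ i $ j" for i j
    using arg_cong[OF assms, of "\<lambda>M. M $ i $ j"] by (simp add: transpose_def)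
  show ?thesis
    by (simp add: qform_def matrix_vector_mult_def inner_vec_def sum_6 algebra_simps
        sym[of 2 1] sym[of 3 1] sym[of 4 1] sym[of 5 1] sym[of 6 1] sym[of 3 2] sym[of 4 2] sym[of 5 2]
        sym[of 6 2] sym[of 4 3] sym[of 5 3] sym[of 6 3] sym[of 5 4] sym[of 6 4] sym[of 6 5])
qed

text \<open>This reduces optimality among all symmetric perturbations to the two scalar identities
  \<open>hole_weight_E6_dual\<close> and \<open>hole_weight_R1\<close>.\<close>

lemma invariant_form:
  fixes A :: "real^6^6"
  assumes sym: "transpose A = A" and inv: "\<And>g x. g \<in> isos \<Longrightarrow> qform A (g x) = qform A x"
  obtains a b where "\<And>x. qform A x = a * qform Q_E6_dual x + b * qform R1 x"
proof -

  \<comment> \<open>Instances of the invariance that cut the 21-dimensional space of symmetric matrices down to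
    the span of \<open>Q_E6_dual\<close> and \<open>R1\<close>.\<close>
  have e1: "- A $ 3 $ 3 + A $ 4 $ 4 = 0"
    using inv[OF iso1, of "vector [0, 0, 1, 0, 0, 0]"]
    by (simp add: iso1_def matrix_vector_6 inner_vector_6 qform_6_symmetric[OF sym])
  have e2: "A $ 2 $ 2 - A $ 6 $ 6 = 0"
    using inv[OF iso10, of "vector [0, 0, 0, 0, 0, 1]"]
    by (simp add: iso10_def matrix_vector_6 inner_vector_6 qform_6_symmetric[OF sym])
  have e3: "- 2 * A $ 2 $ 4 + A $ 4 $ 4 = 0"
    using inv[OF iso1, of "vector [0, 1, 0, 0, 0, 0]"]
    by (simp add: iso1_def matrix_vector_6 inner_vector_6 qform_6_symmetric[OF sym])
  have e4: "A $ 4 $ 4 - 2 * A $ 4 $ 6 = 0"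
    using inv[OF iso1, of "vector [0, 0, 0, 0, 0, 1]"]
    by (simp add: iso1_def matrix_vector_6 inner_vector_6 qform_6_symmetric[OF sym])
  have e5: "2 * A $ 2 $ 3 - A $ 3 $ 3 = 0"
    using inv[OF iso1, of "vector [0, 1, -1, 0, 0, 0]"]
    by (simp add: iso1_def matrix_vector_6 inner_vector_6 qform_6_symmetric[OF sym])
  have e6: "- A $ 3 $ 3 + 2 * A $ 3 $ 6 = 0"
    using inv[OF iso1, of "vector [0, 0, 1, 0, 0, -1]"]
    by (simp add: iso1_def matrix_vector_6 inner_vector_6 qform_6_symmetric[OF sym])
  have e7: "A $ 1 $ 1 - 2 * A $ 1 $ 2 + 2 * A $ 1 $ 5 = 0"
    using inv[OF iso1, of "vector [0, 1, 0, 0, -1, 0]"]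
    by (simp add: iso1_def matrix_vector_6 inner_vector_6 qform_6_symmetric[OF sym])
  have e8: "A $ 1 $ 1 + 2 * A $ 1 $ 5 - 2 * A $ 1 $ 6 = 0"
    using inv[OF iso1, of "vector [0, 0, 0, 0, 1, -1]"]
    by (simp add: iso1_def matrix_vector_6 inner_vector_6 qform_6_symmetric[OF sym])
  have e9: "A $ 1 $ 1 - 2 * A $ 1 $ 3 + A $ 3 $ 3 - A $ 4 $ 4 = 0"
    using inv[OF iso1, of "vector [0, 0, 0, 1, 0, 0]"]
    by (simp add: iso1_def matrix_vector_6 inner_vector_6 qform_6_symmetric[OF sym])
  have e10: "- A $ 1 $ 1 + 2 * A $ 1 $ 4 + A $ 3 $ 3 - A $ 4 $ 4 = 0"
    using inv[OF iso1, of "vector [1, 0, 0, -1, 0, 0]"]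
    by (simp add: iso1_def matrix_vector_6 inner_vector_6 qform_6_symmetric[OF sym])
  have e11: "A $ 2 $ 2 - 2 * A $ 2 $ 3 + A $ 3 $ 3 - A $ 5 $ 5 = 0"
    using inv[OF iso8, of "vector [0, 0, 0, 0, 1, 0]"]
    by (simp add: iso8_def matrix_vector_6 inner_vector_6 qform_6_symmetric[OF sym])
  have e12: "- A $ 1 $ 1 - 2 * A $ 1 $ 5 + A $ 4 $ 4 - 2 * A $ 4 $ 5 = 0"
    using inv[OF iso1, of "vector [1, 0, 0, 0, 1, 0]"]
    by (simp add: iso1_def matrix_vector_6 inner_vector_6 qform_6_symmetric[OF sym])
  have e13: "A $ 1 $ 1 + 2 * A $ 1 $ 5 - A $ 3 $ 3 + 2 * A $ 3 $ 5 = 0"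
    using inv[OF iso1, of "vector [0, 0, 1, 0, -1, 0]"]
    by (simp add: iso1_def matrix_vector_6 inner_vector_6 qform_6_symmetric[OF sym])
  have e14: "A $ 2 $ 2 - 2 * A $ 2 $ 5 + 2 * A $ 5 $ 6 - A $ 6 $ 6 = 0"
    using inv[OF iso3, of "vector [0, 0, 0, 0, 1, -1]"]
    by (simp add: iso3_def matrix_vector_6 inner_vector_6 qform_6_symmetric[OF sym])
  have e15: "- 4 * A $ 1 $ 2 + 2 * A $ 1 $ 4 - 2 * A $ 2 $ 4 + A $ 4 $ 4 = 0"
    using inv[OF iso1, of "vector [1, 1, 0, 0, 0, 0]"]
    by (simp add: iso1_def matrix_vector_6 inner_vector_6 qform_6_symmetric[OF sym])
  have e16: "A $ 1 $ 1 - 2 * A $ 1 $ 3 + 2 * A $ 1 $ 4 - 4 * A $ 3 $ 4 = 0"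
    using inv[OF iso1, of "vector [0, 0, 1, 1, 0, 0]"]
    by (simp add: iso1_def matrix_vector_6 inner_vector_6 qform_6_symmetric[OF sym])
  have e17: "- A $ 1 $ 1 + 2 * A $ 1 $ 3 + A $ 2 $ 2 - 2 * A $ 2 $ 5 - A $ 3 $ 3 + A $ 5 $ 5 = 0"
    using inv[OF iso5, of "vector [1, 0, -1, 0, 0, 0]"]
    by (simp add: iso5_def matrix_vector_6 inner_vector_6 qform_6_symmetric[OF sym])
  have e18: "- A $ 2 $ 2 + 2 * A $ 2 $ 6 + A $ 3 $ 3 - 2 * A $ 3 $ 4 + A $ 4 $ 4 - A $ 6 $ 6 = 0"
    using inv[OF iso11, of "vector [0, 1, 0, 0, 0, -1]"]
    by (simp add: iso11_def matrix_vector_6 inner_vector_6 qform_6_symmetric[OF sym])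
  have e19: "- 2 * A $ 2 $ 3 - 2 * A $ 2 $ 4 + 2 * A $ 2 $ 5 + 2 * A $ 2 $ 6 + A $ 3 $ 3
    + 2 * A $ 3 $ 4 - 2 * A $ 3 $ 6 + A $ 4 $ 4 - 2 * A $ 4 $ 6 - A $ 5 $ 5 + A $ 6 $ 6 = 0"
    using inv[OF iso3, of "vector [0, 1, 0, 0, -1, 0]"]
    by (simp add: iso3_def matrix_vector_6 inner_vector_6 qform_6_symmetric[OF sym])
  \<comment> \<open>Solved from the entries (2,2) and (3,3), which are 4, 7 and 4, 8 in
    \<open>Q_E6_dual\<close> and \<open>R1\<close>. The other entries then follow one after another
    from the nineteen equations.\<close>
  define a where "a = 2 * A $ 2 $ 2 - 7 / 4 * A $ 3 $ 3"
  define b where "b = A $ 3 $ 3 - A $ 2 $ 2"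
  have A22: "A $ 2 $ 2 = 4 * a + 7 * b" and A33: "A $ 3 $ 3 = 4 * a + 8 * b"
    by (simp_all add: a_def b_def)
  have A23: "A $ 2 $ 3 = 2 * a + 4 * b"
    using A22 A33 e5 by linarith
  have A36: "A $ 3 $ 6 = 2 * a + 4 * b"
    using A22 A33 e6 by linarith
  have A44: "A $ 4 $ 4 = 4 * a + 8 * b"
    using A22 A33 e1 by linarith
  have A24: "A $ 2 $ 4 = 2 * a + 4 * b"
    using A22 A33 A44 e3 by linarith
  have A46: "A $ 4 $ 6 = 2 * a + 4 * b"
    using A22 A33 A44 e4 by linarith
  have A55: "A $ 5 $ 5 = 4 * a + 7 * b"
    using A22 A33 A23 e11 by linarith
  have A66: "A $ 6 $ 6 = 4 * a + 7 * b"
    using A22 A33 e2 by linarith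
  have A25: "A $ 2 $ 5 = 2 * a + 3 * b"
    using A22 A33 A44 A55 e9 e17 by linarith
  have A56: "A $ 5 $ 6 = 2 * a + 3 * b"
    using A22 A33 A66 A25 e14 by linarith
  have A26: "A $ 2 $ 6 = a + 2 * b"
    using A22 A33 A23 A36 A44 A24 A46 A55 A25 e18 e19 by linarith
  have A34: "A $ 3 $ 4 = a + 3 * b"
    using A22 A33 A44 A66 A26 e18 by linarith
  have A14: "A $ 1 $ 4 = 2 * a + 6 * b"
    using A22 A33 A44 A34 e9 e16 by linarith
  have A11: "A $ 1 $ 1 = 4 * a + 12 * b"
    using A22 A33 A44 A14 e10 by linarith
  have A12: "A $ 1 $ 2 = a + 3 * b"
    using A22 A33 A44 A24 A14 e15 by linarith
  have A13: "A $ 1 $ 3 = 2 * a + 6 * b"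
    using A22 A33 A44 A11 e9 by linarith
  have A15: "A $ 1 $ 5 = - a - 3 * b"
    using A22 A33 A11 A12 e7 by linarith
  have A16: "A $ 1 $ 6 = a + 3 * b"
    using A22 A33 A11 A15 e8 by linarith
  have A35: "A $ 3 $ 5 = a + 1 * b"
    using A22 A33 A11 A15 e13 by linarith
  have A45: "A $ 4 $ 5 = a + 1 * b"
    using A22 A33 A44 A11 A15 e12 by linarith
  have "qform A x = a * qform Q_E6_dual x + b * qform R1 x" for x
    unfolding qform_6_symmetric[OF sym] qform_6_symmetric[OF Q_E6_dual_sym] qform_6_symmetric[OF R1_sym]
    by (simp add: A11 A12 A13 A14 A15 A16 A22 A23 A24 A25 A26 A33 A34 A35 A36 A44 A45 A46 A55 A56
      A66 Q_E6_dual_def R1_def algebra_simps)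
  then show thesis
    by (rule that)
qed

section \<open>Packing and covering constants of \<open>Q_pc_6\<close>\<close>

text \<open>The bound is the value at the second unit vector, which is an edge from 0 in all three
  cells.\<close>

lemma edges_cell0: "\<forall>u\<in>cell0. \<forall>v\<in>cell0. u \<noteq> v \<longrightarrow> 4 + 7 * pc_t \<le> qform Q_pc_6 (u - v)"
  using pc_t_pos by (simp add: cell0_def vector_value_simps algebra_simps)

lemma edges_cell1: "\<forall>u\<in>cell1. \<forall>v\<in>cell1. u \<noteq> v \<longrightarrow> 4 + 7 * pc_t \<le> qform Q_pc_6 (u - v)"
  using pc_t_pos by (simp add: cell1_def vector_value_simps algebra_simps)

lemma edges_cell2: "\<forall>u\<in>cell2. \<forall>v\<in>cell2. u \<noteq> v \<longrightarrow> 4 + 7 * pc_t \<le> qform Q_pc_6 (u - v)"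
  using pc_t_pos by (simp add: cell2_def vector_value_simps algebra_simps)

lemma packing_lambda_Q_pc_6: "4 + 7 * pc_t \<le> packing_lambda Q_pc_6"
proof (rule pc.packing_lambda_ge_edges[OF Q_pc_6_pqf Q_pc_6_regular])
  fix V u v
  assume "V \<in> orbit_family {Q_E6_dual, R1} reps" and uv: "u \<in> V" "v \<in> V" "u \<noteq> v"
  then obtain U g where g: "U \<in> reps" "g \<in> isos" "V = g ` U"
    unfolding orbit_family_def by blast
  then obtain a b where ab: "a \<in> U" "b \<in> U" "u = g a" "v = g b"
    using uv by blast
  have "u - v = g (a - b)"
    by (simp add: ab linear_diff[OF isometries_linear[OF g(2)]])
  then have "qform Q_pc_6 (u - v) = qform Q_pc_6 (a - b)"
    by (simp add: Q_pc_6_isos[OF g(2)])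
  moreover have "a \<noteq> b"
    using uv(3) ab by blast
  then have "4 + 7 * pc_t \<le> qform Q_pc_6 (a - b)"
    using g(1) ab(1,2) edges_cell0 edges_cell1 edges_cell2 by blast
  ultimately show "4 + 7 * pc_t \<le> qform Q_pc_6 (u - v)"
    by simp
qed

lemma sqrt_798_mult: "sqrt 798 * (sqrt 798 * x) = 798 * x"
  by (simp flip: mult.assoc)

text \<open>The exact circumcentre of \<open>cell2\<close> for \<open>Q_pc_6\<close>, with squared
  radius \<open>mu_pc\<close> (\<open>ball_cell2\<close>).\<close>

definition deep_hole :: "real^6" where
  "deep_hole = vector [3 / 14 * sqrt 798 - 6, 0, 7 - 5 / 21 * sqrt 798, 3 - 2 / 21 * sqrt 798, 4 / 21 * sqrt 798 - 5, 0]"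

abbreviation mu_pc :: real where "mu_pc \<equiv> (532 - 12 * sqrt 798) / 79"

text \<open>For \<open>cell0\<close> and \<open>cell1\<close> a rational point close to the circumcentre suffices.\<close>

lemma ball_cell0: "\<forall>v\<in>cell0. qform Q_pc_6 (v - vector [1/20, 0, 31/100, 31/100, 69/200, 0]) \<le> mu_pc"
  using sqrt_798_bounds by (simp add: cell0_def vector_value_simps pc_t_def field_simps)

lemma ball_cell1: "\<forall>v\<in>cell1. qform Q_pc_6 (v - vector [-1/58, 0, 20/58, 20/58, 18/58, 0]) \<le> mu_pc"
  using sqrt_798_bounds by (simp add: cell1_def vector_value_simps pc_t_def field_simps)

lemma ball_cell2: "\<forall>v\<in>cell2. qform Q_pc_6 (v - deep_hole) = mu_pc"
  by (simp add: cell2_def deep_hole_def vector_value_simps pc_t_def field_simps sqrt_798_mult)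

lemma covering_mu_Q_pc_6: "covering_mu Q_pc_6 \<le> mu_pc"
proof (rule pc.covering_mu_le_cells[OF Q_pc_6_pqf Q_pc_6_regular])
  fix V
  assume "V \<in> orbit_family {Q_E6_dual, R1} reps"
  then obtain U g where g: "U \<in> reps" "g \<in> isos" "V = g ` U"
    unfolding orbit_family_def by blast
  have "\<exists>p. \<forall>v\<in>U. qform Q_pc_6 (v - p) \<le> mu_pc"
    using g(1) ball_cell0 ball_cell1 ball_cell2 by (metis insertE emptyE order_refl)
  then obtain p where p: "\<And>v. v \<in> U \<Longrightarrow> qform Q_pc_6 (v - p) \<le> mu_pc"
    by blast
  have "qform Q_pc_6 (g v - g p) = qform Q_pc_6 (v - p)" for v
    by (metis Q_pc_6_isos[OF g(2)] linear_diff[OF isometries_linear[OF g(2)]])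
  then show "\<exists>p. \<forall>v\<in>V. qform Q_pc_6 (v - p) \<le> mu_pc"
    using p g(3) by (intro exI[of _ "g p"]) simp
qed

text \<open>The barycentric coordinates of \<open>deep_hole\<close> in \<open>cell2\<close>, written as an affine function of the vertex.\<close>

definition hole_weight :: "real^6 \<Rightarrow> real" where
  "hole_weight v = sqrt 798 / 7 - 4 + (11 - 8 / 21 * sqrt 798) * (v $ 2 + v $ 6)
     + (35 - 17 / 14 * sqrt 798) * v $ 3 + (sqrt 798 / 14 - 2) * v $ 5"

lemma hole_weight_vector: "hole_weight (vector [a, b, c, d, e, f]) = sqrt 798 / 7 - 4 + (11 - 8 / 21 * sqrt 798) * (b + f)
     + (35 - 17 / 14 * sqrt 798) * c + (sqrt 798 / 14 - 2) * e"
  "hole_weight 0 = sqrt 798 / 7 - 4"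
  by (simp_all add: hole_weight_def)

lemma hole_weight_sum: "sum hole_weight cell2 = 1"
  by (simp add: cell2_def vector_6_eq_iff hole_weight_vector field_simps)

lemma hole_weight_deep_hole: "deep_hole = (\<Sum>v\<in>cell2. hole_weight v *\<^sub>R v)"
  by (simp add: cell2_def vector_6_eq_iff hole_weight_vector vector_6_arith deep_hole_def field_simps)

text \<open>The factor 4, and 7 in \<open>hole_weight_R1\<close>, is the value of the form at the
  second unit vector. That the remaining factor is the same in both identities is the stationarity
  which singles out \<open>pc_t\<close>; it is \<open>mu_pc\<close> divided by 4 + 7
  \<open>pc_t\<close>.\<close>

lemma hole_weight_E6_dual: "(\<Sum>v\<in>cell2. hole_weight v * qform Q_E6_dual (v - deep_hole)) = (2 * sqrt 798 - 56) * 4"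
  by (simp add: cell2_def vector_6_eq_iff hole_weight_vector vector_value_simps deep_hole_def field_simps sqrt_798_mult)

lemma hole_weight_R1: "(\<Sum>v\<in>cell2. hole_weight v * qform R1 (v - deep_hole)) = (2 * sqrt 798 - 56) * 7"
  by (simp add: cell2_def vector_6_eq_iff hole_weight_vector vector_value_simps deep_hole_def field_simps sqrt_798_mult)

lemma packing_covering_bound_Q_pc_6:
  assumes "Q \<in> pqf" "pc.regular Q"
  shows "(2 * sqrt 798 - 56) * packing_lambda Q \<le> covering_mu Q"
proof (rule packing_covering_bound[OF pc.simplex_family_axioms _ Q_E6_dual_pqf])
  show "cell2 \<in> reps" "finite cell2" "sum hole_weight cell2 = 1" "deep_hole = (\<Sum>v\<in>cell2. hole_weight v *\<^sub>R v)"
    using hole_weight_sum hole_weight_deep_hole by (simp_all add: cell2_def)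
  show "vector [0, 1, 0, 0, 0, 0] \<in> (int_vecs :: (real^6) set)" "vector [0, 1, 0, 0, 0, 0] \<noteq> (0 :: real^6)"
    by (simp_all add: int_vecs_6 vector_6_eq_iff)
  show "0 \<le> 2 * sqrt 798 - 56"
    using sqrt_798_bounds by simp
  show "(\<Sum>v\<in>cell2. hole_weight v * qform A (v - deep_hole)) = (2 * sqrt 798 - 56) * qform A (vector [0, 1, 0, 0, 0, 0])"
    if A: "transpose A = A" "\<And>g x. g \<in> isos \<Longrightarrow> qform A (g x) = qform A x" for A
  proof -
    obtain a b where ab: "\<And>x. qform A x = a * qform Q_E6_dual x + b * qform R1 x"
      using invariant_form A by blast
    have "(\<Sum>v\<in>cell2. hole_weight v * qform A (v - deep_hole)) =
        a * (\<Sum>v\<in>cell2. hole_weight v * qform Q_E6_dual (v - deep_hole)) +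
        b * (\<Sum>v\<in>cell2. hole_weight v * qform R1 (v - deep_hole))"
      unfolding ab sum_distrib_left sum.distrib[symmetric] by (intro sum.cong refl) (simp add: algebra_simps)
    also have "\<dots> = (2 * sqrt 798 - 56) * qform A (vector [0, 1, 0, 0, 0, 0])"
      unfolding hole_weight_E6_dual hole_weight_R1 ab
      by (simp add: qform_E6_dual_vector qform_R1_vector algebra_simps)
    finally show ?thesis .
  qed
qed (use assms in simp_all)

lemma mu_pc_eq: "mu_pc = (2 * sqrt 798 - 56) * (4 + 7 * pc_t)"
  by (simp add: pc_t_def field_simps)

lemma covering_mu_le_Q_pc_6: "covering_mu Q_pc_6 \<le> (2 * sqrt 798 - 56) * packing_lambda Q_pc_6"
proof -
  have "mu_pc \<le> (2 * sqrt 798 - 56) * packing_lambda Q_pc_6"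
    unfolding mu_pc_eq using packing_lambda_Q_pc_6 sqrt_798_bounds by (intro mult_left_mono) auto
  then show ?thesis
    using covering_mu_Q_pc_6 by simp
qed

text \<open>The general lower bound, applied to \<open>Q_pc_6\<close> itself, closes the chain of
  inequalities through \<open>mu_pc\<close>. The one-sided estimates of lambda and mu thus become
  equalities without separate proofs.\<close>

lemma packing_covering_gamma_Q_pc_6: "packing_covering_gamma Q_pc_6 = 2 * sqrt (2 * sqrt 798 - 56)"
proof -
  have "covering_mu Q_pc_6 = (2 * sqrt 798 - 56) * packing_lambda Q_pc_6"
    using covering_mu_le_Q_pc_6 packing_covering_bound_Q_pc_6[OF Q_pc_6_pqf Q_pc_6_regular] by simp
  then show ?thesis
    using packing_lambda_pos[OF Q_pc_6_pqf] by (simp add: packing_covering_gamma_def)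
qed

lemma gamma_approx: "\<bar>2 * sqrt (2 * sqrt 798 - 56) - 1.411081242\<bar> < 1 / 10 ^ 9"
proof -
  \<comment> \<open>Many digits are required: the rounded decimal differs from the constant by
    between 0.82 and 0.84 times 10^-9, close to the permitted 10^-9.\<close>
  have s: "28.248893783651 < sqrt 798" "sqrt 798 < 28.2488937836511"
    by (rule real_less_rsqrt, simp add: power2_eq_square, rule real_less_lsqrt, simp_all add: power2_eq_square)
  have "0.70554062058 < sqrt (2 * sqrt 798 - 56)"
    by (rule real_less_rsqrt) (use s(1) in \<open>simp add: power2_eq_square\<close>)
  moreover have "sqrt (2 * sqrt 798 - 56) < 0.70554062059"
    by (rule real_less_lsqrt) (use s in \<open>simp_all add: power2_eq_square\<close>)
  ultimately show ?thesis
    by (simp add: abs_less_iff)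
qed

theorem theorem11p10:
  shows "Q_pc_6 \<in> pqf
    \<and> locally_optimal_packing_covering Q_pc_6
    \<and> in_interior_of_secondary_cone Q_pc_6
    \<and> packing_covering_gamma Q_pc_6 = 2 * sqrt (2 * sqrt 798 - 56)
    \<and> \<bar>packing_covering_gamma Q_pc_6 - 1.411081242\<bar> < 1 / 10 ^ 9"
  using Q_pc_6_pqf pc.in_interior_of_secondary_cone[OF Q_pc_6_pqf Q_pc_6_regular]
    locally_optimal_packing_coveringI[OF pc.simplex_family_axioms Q_pc_6_pqf Q_pc_6_regular
      packing_covering_bound_Q_pc_6 covering_mu_le_Q_pc_6]
    packing_covering_gamma_Q_pc_6 gamma_approx by simp

end
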